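(* Assume that $G$ is a finitely generated group with exponential volume growth and such that $\Phi_G(n)\simeq\exp(-n^{1/3})$. Let $\rho:[0,\infty)\to[1,\infty)$ be a continuous increasing function with $$\rho(t)\simeq\left(\int_t^\infty\frac{ds}{(1+s)\ell(s)}\right)^{-1}$$ where $\ell:[0,\infty)\to[1,\infty)$ is continuous, increasing and regularly varying of some index $\ge0$, with $\int_0^\infty\frac{ds}{(1+s)\ell(s)}<\infty$. 1. If $\rho$ is regularly varying of index $2$, then $$\widetilde\Phi_{G,\rho}(n)\gtrsim\exp\left(-n^{1/3}\int_0^{n^{1/3}}\frac{s\,ds}{\rho(s)}\right).$$ 2. If $\rho(s)=(1+s)^\alpha$ with $\alpha\in(0,2)$, then $$\widetilde\Phi_{G,\rho}(n)\simeq\exp\left(-n^{1/(1+\alpha)}\right).$$ 3. If $\rho$ is slowly varying and satisfies $\rho(s^a)\simeq\rho(s)$ for any $a>0$, then $$\widetilde\Phi_{G,\rho}(n)\simeq\exp(-n/\rho(n)).$$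
   Context: $G$ is equipped with a fixed finite symmetric generating set $S^*$ containing the identity $e$ and the associated word length $|\cdot|$; $\mathbf u$ is the uniform probability measure on $S^*$ and $\Phi_G$ is represented by $\Phi_G(n)=\mathbf u^{(n)}(e)$, where $\phi^{(n)}$ denotes the $n$-fold convolution power. For a probability measure $\mu$ on $G$, $W(\rho,\mu)=\sup_{s>0}\{s\,\mu(\{g:\rho(|g|)>s\})\}$ and $$\widetilde\Phi_{G,\rho}(n)=\inf\{\phi^{(2n)}(e):\phi\text{ symmetric probability measure on }G,\ W(\rho,\phi)\le2\rho(0)\}.$$ For monotone functions near infinity (on integers extended to reals by integer parts), $f\gtrsim g$ means $f(t)\ge c_1g(c_2t)$ for some constants $c_1,c_2\in(0,\infty)$, and $f\simeq g$ means $f\gtrsim g$ and $g\gtrsim f$. *)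

theory Defs
  imports "HOL-Probability.Probability" "HOL-Algebra.Generated_Groups"
begin

section \<open>Comparison of functions near infinity\<close>

text \<open>The constant \<open>c\<^sub>2\<close> dilates the argument, so this is coarser than comparison up to a
  multiplicative constant; in particular \<open>exp (- t)\<close> and \<open>exp (- 2 * t)\<close> are equivalent.\<close>

definition dil_ge :: "(real \<Rightarrow> real) \<Rightarrow> (real \<Rightarrow> real) \<Rightarrow> bool" (infix \<open>\<greatersim>\<^sub>d\<close> 50) where
  "f \<greatersim>\<^sub>d g \<longleftrightarrow> (\<exists>c\<^sub>1>0. \<exists>c\<^sub>2>0. \<forall>\<^sub>F t in at_top. f t \<ge> c\<^sub>1 * g (c\<^sub>2 * t))"

definition dil_equiv :: "(real \<Rightarrow> real) \<Rightarrow> (real \<Rightarrow> real) \<Rightarrow> bool" (infix \<open>\<simeq>\<^sub>d\<close> 50) where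
  "f \<simeq>\<^sub>d g \<longleftrightarrow> f \<greatersim>\<^sub>d g \<and> g \<greatersim>\<^sub>d f"

definition real_ext :: "(nat \<Rightarrow> real) \<Rightarrow> real \<Rightarrow> real" where
  "real_ext a t = a (nat \<lfloor>t\<rfloor>)"

text \<open>Regular variation at infinity. Positivity and measurability, usually part of the notion, are
  not included: it is only used for continuous functions from \<open>[0,\<infinity>)\<close> to \<open>[1,\<infinity>)\<close>.\<close>

definition regularly_varying :: "real \<Rightarrow> (real \<Rightarrow> real) \<Rightarrow> bool" where
  "regularly_varying \<beta> f \<longleftrightarrow> (\<forall>c>0. ((\<lambda>x. f (c * x) / f x) \<longlongrightarrow> c powr \<beta>) at_top)"

abbreviation slowly_varying :: "(real \<Rightarrow> real) \<Rightarrow> bool" where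
  "slowly_varying \<equiv> regularly_varying 0"


section \<open>Word length and volume growth\<close>

context
  fixes G :: "('a, 'b) monoid_scheme" (structure)
begin

definition symmetric_generating_set :: "'a set \<Rightarrow> bool" where
  "symmetric_generating_set S \<longleftrightarrow>
     finite S \<and> S \<subseteq> carrier G \<and> \<one> \<in> S \<and> (\<forall>s\<in>S. inv s \<in> S) \<and> generate G S = carrier G"

definition word_length :: "'a set \<Rightarrow> 'a \<Rightarrow> nat" where
  "word_length S g = (LEAST n. \<exists>ws. length ws = n \<and> set ws \<subseteq> S \<and> foldr (\<otimes>) ws \<one> = g)"

definition volume :: "'a set \<Rightarrow> nat \<Rightarrow> nat" where
  "volume S n = card {g \<in> carrier G. word_length S g \<le> n}"

definition exponential_growth :: "'a set \<Rightarrow> bool" where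
  "exponential_growth S \<longleftrightarrow> (\<exists>c>0. \<forall>n. real (volume S n) \<ge> exp (c * real n))"


section \<open>Probability measures on a group\<close>

text \<open>A finitely generated group is countable, so its probability measures are exactly the
  probability mass functions supported on the carrier.\<close>

definition symmetric_prob :: "'a pmf \<Rightarrow> bool" where
  "symmetric_prob \<phi> \<longleftrightarrow> set_pmf \<phi> \<subseteq> carrier G \<and> (\<forall>g\<in>carrier G. pmf \<phi> (inv g) = pmf \<phi> g)"

definition convolve :: "'a pmf \<Rightarrow> 'a pmf \<Rightarrow> 'a pmf" where
  "convolve \<phi> \<psi> = map_pmf (\<lambda>(x, y). x \<otimes> y) (pair_pmf \<phi> \<psi>)"

primrec conv_power :: "'a pmf \<Rightarrow> nat \<Rightarrow> 'a pmf" where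
  "conv_power \<phi> 0 = return_pmf \<one>"
| "conv_power \<phi> (Suc n) = convolve \<phi> (conv_power \<phi> n)"

definition return_prob :: "'a set \<Rightarrow> nat \<Rightarrow> real" where
  "return_prob S n = pmf (conv_power (pmf_of_set S) n) \<one>"

text \<open>The weak \<open>\<rho>\<close>-moment \<open>W(\<rho>,\<mu>)\<close>, which may be infinite.\<close>

definition weak_moment :: "'a set \<Rightarrow> (real \<Rightarrow> real) \<Rightarrow> 'a pmf \<Rightarrow> ennreal" where
  "weak_moment S \<rho> \<mu> =
     (SUP s\<in>{0<..}. ennreal (s * measure_pmf.prob \<mu> {g \<in> carrier G. \<rho> (real (word_length S g)) > s}))"

text \<open>The infimum \<open>\<Phi>~\<^sub>G\<^sub>,\<^sub>\<rho>(n)\<close>. The point mass at \<open>\<one>\<close> is admissible when \<open>\<rho> 0 \<ge> 0\<close>, so the infimum is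
  over a nonempty set of nonnegative reals.\<close>

definition weak_return_inf :: "'a set \<Rightarrow> (real \<Rightarrow> real) \<Rightarrow> nat \<Rightarrow> real" where
  "weak_return_inf S \<rho> n =
     Inf {pmf (conv_power \<phi> (2 * n)) \<one> | \<phi>.
            symmetric_prob \<phi> \<and> weak_moment S \<rho> \<phi> \<le> ennreal (2 * \<rho> 0)}"

end

end

theory Submission
  imports Defs "HOL-Real_Asymp.Real_Asymp"
begin

text \<open>Both bounds come from explicit test objects.

  Upper bounds. For each \<open>n\<close> the infimum may be tested with a measure that depends on \<open>n\<close>: with
  probability \<open>p = \<rho> 0 / \<rho> r\<close> jump to a uniform point of the ball of radius \<open>r\<close>, otherwise stay. This
  is admissible because \<open>s\<close> times the probability of \<open>\<rho> |y| > s\<close> is at most \<open>\<rho> 0\<close>. Either none of the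
  \<open>2 n\<close> steps is a jump, with probability at most \<open>exp (- 2 n p)\<close>, or a jump has spread the position so that no
  point has mass above the inverse of the volume of the ball, which is exponentially small in \<open>r\<close>.
  Choosing \<open>r\<close> balances \<open>n / \<rho> r\<close> and \<open>r\<close>.

  Lower bounds. Let \<open>P\<close> be convolution by an admissible measure \<open>\<phi>\<close>, a self-adjoint contraction of
  \<open>\<ell>\<^sup>2\<close>, and let \<open>g\<close> be a symmetric probability. Then \<open>\<phi>^(2n)(e) \<ge> \<langle>P^(2n) g, g\<rangle>\<close>,
  and \<open>\<langle>P^(2n) g, g\<rangle> / \<langle>g, g\<rangle> \<ge> (\<langle>P g, g\<rangle> / \<langle>g, g\<rangle>)^(2n)\<close> because the moments of a self-adjoint
  operator are log-convex (\<open>return_prob_ge_test_function\<close>). The same \<open>g\<close> serves all \<open>\<phi>\<close>: it is a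
  convolution power \<open>u^(k)\<close> of the uniform measure with \<open>k < r\<^sup>3\<close>. Since
  \<open>u^(2k)(e)\<close> decreases by no more than a factor \<open>exp (- A r)\<close> while \<open>k\<close> runs up to \<open>r\<^sup>3\<close>, some step
  costs a factor of at least \<open>1 - A / r\<^sup>2\<close> (\<open>exists_slow_decay\<close>). For this \<open>k\<close> the translate of \<open>g\<close> by a
  generator, and by the triangle inequality the translate by any \<open>y\<close>, satisfies
  \<open>\<parallel>y g - g\<parallel>\<^sup>2 \<le> C (|y| / r)\<^sup>2 \<parallel>g\<parallel>\<^sup>2\<close> (\<open>corr_defect\<close>). Averaging \<open>min 1 ((|y| / r)\<^sup>2)\<close> over \<open>\<phi>\<close>, with
  the tail bound from the weak moment, gives a multiple of \<open>J r = r^(-2) \<integral>\<^sub>0\<^sup>r s / \<rho> s ds\<close>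
  (\<open>truncated_second_moment_le\<close>). Hence the infimum is at least \<open>exp (- C (r + n J r))\<close>
  (\<open>weak_return_inf_lower_bound\<close>) as soon as \<open>J r\<close> is small, and \<open>J\<close> tends to 0 because \<open>\<rho>\<close> is unbounded.

  It remains to choose \<open>r\<close>. In the first case \<open>r = n^(1/3)\<close>. In the other two, \<open>\<rho>\<close> grows no faster
  than some power below 2, so that \<open>J r\<close> is at most of order \<open>1 / \<rho> r\<close> (\<open>ratio_average_Karamata\<close>), and \<open>r\<close> is
  \<open>n^(1/(1+\<alpha>))\<close> or \<open>n^(1/2)\<close>; in the slowly varying case \<open>\<rho> (n^(1/2))\<close> is comparable with \<open>\<rho> n\<close> and
  \<open>n^(1/2)\<close> is negligible against \<open>n / \<rho> n\<close>.\<close>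

section \<open>Convolution of probability measures on a group\<close>

lemma integrable_measure_pmf_bounded:
  fixes f :: "'a \<Rightarrow> real"
  assumes "\<And>x. \<bar>f x\<bar> \<le> B"
  shows "integrable (measure_pmf p) f"
  by (rule measure_pmf.integrable_const_bound[where B=B]) (simp_all add: assms)

context group
begin

abbreviation conv (infixr \<open>\<odot>\<close> 70) where "p \<odot> q \<equiv> convolve G p q"

definition reflect :: "'a pmf \<Rightarrow> 'a pmf" where
  "reflect p = map_pmf (\<lambda>x. inv x) p"

text \<open>The monadic form reduces associativity and the exchange of the factors to the laws of
  \<open>bind_pmf\<close>, without infinite sums.\<close>

lemma convolve_bind: "p \<odot> q = bind_pmf p (\<lambda>x. map_pmf (\<lambda>y. x \<otimes> y) q)"
  unfolding convolve_def pair_pmf_def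
  by (simp add: map_bind_pmf map_pmf_def bind_assoc_pmf bind_return_pmf)

lemma convolve_bind': "p \<odot> q = bind_pmf q (\<lambda>y. map_pmf (\<lambda>x. x \<otimes> y) p)"
  unfolding convolve_bind map_pmf_def by (rule bind_commute_pmf)

lemma set_convolve:
  assumes "set_pmf p \<subseteq> carrier G" "set_pmf q \<subseteq> carrier G"
  shows "set_pmf (p \<odot> q) \<subseteq> carrier G"
  using assms by (auto simp: convolve_bind)

lemma convolve_assoc:
  assumes "set_pmf p \<subseteq> carrier G" "set_pmf q \<subseteq> carrier G" "set_pmf r \<subseteq> carrier G"
  shows "(p \<odot> q) \<odot> r = p \<odot> (q \<odot> r)"
  unfolding convolve_bind bind_map_pmf map_bind_pmf bind_assoc_pmf pmf.map_comp
  using assms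
  by (intro bind_pmf_cong refl pmf.map_cong0) (auto intro!: m_assoc)

lemma convolve_one_left: "set_pmf p \<subseteq> carrier G \<Longrightarrow> return_pmf \<one> \<odot> p = p"
  unfolding convolve_bind bind_return_pmf by (intro map_pmf_idI) auto

lemma convolve_one_right: "set_pmf p \<subseteq> carrier G \<Longrightarrow> p \<odot> return_pmf \<one> = p"
  unfolding convolve_bind' bind_return_pmf by (intro map_pmf_idI) auto

lemma set_conv_power: "set_pmf p \<subseteq> carrier G \<Longrightarrow> set_pmf (conv_power G p n) \<subseteq> carrier G"
  by (induction n) (simp_all add: set_convolve)

lemma conv_power_add:
  assumes "set_pmf p \<subseteq> carrier G"
  shows "conv_power G p (m + n) = conv_power G p m \<odot> conv_power G p n"
  by (induction m) (auto simp: convolve_one_left convolve_assoc assms set_conv_power)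

lemma set_reflect: "set_pmf p \<subseteq> carrier G \<Longrightarrow> set_pmf (reflect p) \<subseteq> carrier G"
  by (auto simp: reflect_def)

lemma pmf_reflect:
  assumes "set_pmf p \<subseteq> carrier G" "x \<in> carrier G"
  shows "pmf (reflect p) x = pmf p (inv x)"
proof -
  have "pmf (reflect p) x = measure (measure_pmf p) ((\<lambda>x. inv x) -` {x})"
    by (simp add: reflect_def pmf_map)
  also have "\<dots> = measure (measure_pmf p) {inv x}"
  proof (intro measure_pmf.finite_measure_eq_AE)
    show "AE y in p. y \<in> (\<lambda>x. inv x) -` {x} \<longleftrightarrow> y \<in> {inv x}"
      unfolding AE_measure_pmf_iff using assms by (metis inv_inv singleton_iff subsetD vimage_singleton_eq)
  qed auto
  finally show ?thesis by (simp add: measure_pmf_single)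
qed

lemma symmetric_prob_iff_reflect:
  "symmetric_prob G p \<longleftrightarrow> set_pmf p \<subseteq> carrier G \<and> reflect p = p"
proof -
  have "pmf (reflect p) x = pmf p x" if "set_pmf p \<subseteq> carrier G" "x \<notin> carrier G" for x
    using that set_reflect[of p] by (metis pmf_eq_0_set_pmf subset_eq)
  then show ?thesis
    unfolding symmetric_prob_def by (metis pmf_reflect pmf_eqI)
qed

lemma reflect_convolve:
  assumes "set_pmf p \<subseteq> carrier G" "set_pmf q \<subseteq> carrier G"
  shows "reflect (p \<odot> q) = reflect q \<odot> reflect p"
proof -
  have "reflect (p \<odot> q) = bind_pmf q (\<lambda>y. map_pmf (\<lambda>x. inv (x \<otimes> y)) p)"
    by (simp add: reflect_def convolve_bind' map_bind_pmf pmf.map_comp comp_def)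
  also have "\<dots> = bind_pmf q (\<lambda>y. map_pmf (\<lambda>x. inv y \<otimes> inv x) p)"
    using assms by (intro bind_pmf_cong refl pmf.map_cong0) (auto simp: inv_mult_group subset_eq)
  also have "\<dots> = reflect q \<odot> reflect p"
    by (simp add: reflect_def convolve_bind bind_map_pmf pmf.map_comp comp_def)
  finally show ?thesis .
qed

lemma reflect_conv_power:
  assumes "symmetric_prob G p"
  shows "reflect (conv_power G p n) = conv_power G p n"
proof (induction n)
  case 0 show ?case by (simp add: reflect_def)
next
  case (Suc n)
  have p: "set_pmf p \<subseteq> carrier G" "reflect p = p" using assms symmetric_prob_iff_reflect by auto
  have "reflect (conv_power G p (Suc n)) = conv_power G p n \<odot> conv_power G p 1"
    using p Suc by (simp add: reflect_convolve set_conv_power convolve_one_right)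
  then show ?case by (metis conv_power_add p(1) Suc_eq_plus1)
qed

lemma pmf_translate:
  assumes "set_pmf p \<subseteq> carrier G" "x \<in> carrier G" "z \<in> carrier G"
  shows "pmf (map_pmf (\<lambda>y. x \<otimes> y) p) z = pmf p (inv x \<otimes> z)"
proof -
  have "pmf (map_pmf (\<lambda>y. x \<otimes> y) p) z = measure (measure_pmf p) ((\<lambda>y. x \<otimes> y) -` {z})"
    by (simp add: pmf_map)
  also have "\<dots> = measure (measure_pmf p) {inv x \<otimes> z}"
  proof (intro measure_pmf.finite_measure_eq_AE)
    show "AE y in p. y \<in> (\<lambda>y. x \<otimes> y) -` {z} \<longleftrightarrow> y \<in> {inv x \<otimes> z}"
      unfolding AE_measure_pmf_iff using assms
      by (metis inv_solve_left singleton_iff subsetD vimage_singleton_eq)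
  qed auto
  finally show ?thesis by (simp add: measure_pmf_single)
qed

lemma pmf_convolve:
  assumes "set_pmf p \<subseteq> carrier G" "set_pmf q \<subseteq> carrier G" "z \<in> carrier G"
  shows "pmf (p \<odot> q) z = measure_pmf.expectation p (\<lambda>x. pmf q (inv x \<otimes> z))"
  unfolding convolve_bind pmf_bind using assms
  by (intro integral_cong_AE) (auto simp: AE_measure_pmf_iff pmf_translate)

text \<open>The right-hand side, the expectation of one mass function under the other, is the
  \<open>\<ell>\<^sup>2\<close> inner product of the two mass functions. Inner products are written in this form throughout.\<close>

lemma pmf_convolve_one:
  assumes "set_pmf p \<subseteq> carrier G" "set_pmf q \<subseteq> carrier G"
  shows "pmf (p \<odot> q) \<one> = measure_pmf.expectation p (pmf (reflect q))"
  unfolding pmf_convolve[OF assms one_closed] using assms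
  by (intro integral_cong_AE) (auto simp: AE_measure_pmf_iff pmf_reflect)

lemma pmf_convolve_le_right:
  assumes "set_pmf p \<subseteq> carrier G" "set_pmf q \<subseteq> carrier G" "z \<in> carrier G"
    and "\<And>x. x \<in> carrier G \<Longrightarrow> pmf q x \<le> M"
  shows "pmf (p \<odot> q) z \<le> M"
proof -
  have "pmf (p \<odot> q) z \<le> measure_pmf.expectation p (\<lambda>_. M)"
    unfolding pmf_convolve[OF assms(1-3)] using assms
    by (intro integral_mono_AE integrable_measure_pmf_bounded[where B=1]
          integrable_measure_pmf_bounded[where B="\<bar>M\<bar>" and f="\<lambda>_. M"])
      (auto simp: AE_measure_pmf_iff pmf_le_1)
  then show ?thesis by simp
qed

lemma pmf_convolve_le_left:
  assumes "set_pmf p \<subseteq> carrier G" "set_pmf q \<subseteq> carrier G" "z \<in> carrier G"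
    and "\<And>x. x \<in> carrier G \<Longrightarrow> pmf p x \<le> M"
  shows "pmf (p \<odot> q) z \<le> M"
proof -
  have "pmf (p \<odot> q) z = pmf (reflect q \<odot> reflect p) (inv z)"
    using assms by (metis pmf_reflect reflect_convolve inv_inv inv_closed set_convolve)
  also have "\<dots> \<le> M"
    using assms by (intro pmf_convolve_le_right set_reflect) (simp_all add: pmf_reflect)
  finally show ?thesis .
qed

end

lemma expectation_pmf_eq_sum:
  "measure_pmf.expectation p (pmf q) = (\<integral>x. pmf p x * pmf q x \<partial>count_space UNIV)"
  unfolding measure_pmf_eq_density by (subst integral_real_density) simp_all

lemma integrable_pmf_mult: "integrable (count_space UNIV) (\<lambda>x. pmf p x * pmf q x)"
  by (rule Bochner_Integration.integrable_bound[OF integrable_pmf[of _ p]])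
     (simp_all add: pmf_le_1 mult_left_le)

text \<open>Integrate the square of \<open>A q - C p\<close>, where \<open>A = \<langle>p, p\<rangle>\<close> and \<open>C = \<langle>p, q\<rangle>\<close>, over the
  counting measure, and divide by \<open>A\<close>.\<close>

lemma pmf_Cauchy_Schwarz:
  "(measure_pmf.expectation p (pmf q))\<^sup>2
    \<le> measure_pmf.expectation p (pmf p) * measure_pmf.expectation q (pmf q)"
proof -
  define A B C where "A = measure_pmf.expectation p (pmf p)"
    and "B = measure_pmf.expectation q (pmf q)" and "C = measure_pmf.expectation p (pmf q)"
  note d = A_def B_def C_def expectation_pmf_eq_sum
  have "0 \<le> (\<integral>x. (A * pmf q x - C * pmf p x)\<^sup>2 \<partial>count_space UNIV)"
    by (intro integral_nonneg_AE) simp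
  also have "\<dots> = (\<integral>x. A\<^sup>2 * (pmf q x * pmf q x) - 2 * A * C * (pmf p x * pmf q x)
      + C\<^sup>2 * (pmf p x * pmf p x) \<partial>count_space UNIV)"
    by (intro Bochner_Integration.integral_cong refl) (simp add: power2_eq_square algebra_simps)
  also have "\<dots> = A\<^sup>2 * B - 2 * A * C * C + C\<^sup>2 * A"
    unfolding d
    by (simp add: integrable_pmf_mult Bochner_Integration.integral_add Bochner_Integration.integral_diff
        integrable_mult_right Bochner_Integration.integrable_diff mult.assoc)
  finally have *: "0 \<le> A * (A * B - C\<^sup>2)" by (simp add: power2_eq_square algebra_simps)
  have "A > 0"
  proof -
    obtain x where x: "x \<in> set_pmf p" using set_pmf_not_empty by fast
    have "0 < pmf p x * pmf p x" using x by (simp add: pmf_positive)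
    also have "\<dots> = measure_pmf.expectation p (\<lambda>y. pmf p x * indicator {x} y)"
      by (simp add: measure_pmf_single)
    also have "\<dots> \<le> A" unfolding A_def
      by (intro integral_mono integrable_measure_pmf_bounded[where B=1])
         (simp_all add: pmf_le_1 indicator_def)
    finally show ?thesis .
  qed
  with * have "C\<^sup>2 \<le> A * B" by (simp add: zero_le_mult_iff)
  then show ?thesis by (simp add: A_def B_def C_def)
qed

section \<open>Lower bounds for return probabilities by test functions\<close>

text \<open>The squared \<open>\<ell>\<^sup>2\<close> distance of the mass functions, expanded into inner products; these behave well
  under translations and convolutions.\<close>

definition sq_dist :: "'a pmf \<Rightarrow> 'a pmf \<Rightarrow> real" where
  "sq_dist p q = measure_pmf.expectation p (pmf p) + measure_pmf.expectation q (pmf q)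
     - 2 * measure_pmf.expectation p (pmf q)"

lemma sq_dist_eq_L2_set:
  assumes "finite A" "set_pmf p \<subseteq> A" "set_pmf q \<subseteq> A"
  shows "sqrt (sq_dist p q) = L2_set (\<lambda>x. pmf p x - pmf q x) A"
proof -
  have e: "measure_pmf.expectation r (pmf r') = (\<Sum>x\<in>A. pmf r x * pmf r' x)" if "set_pmf r \<subseteq> A"
    for r r' :: "'a pmf"
    using that assms(1) by (subst integral_measure_pmf[of A]) auto
  have "sq_dist p q = (\<Sum>x\<in>A. (pmf p x - pmf q x)\<^sup>2)"
    unfolding sq_dist_def e[OF assms(2)] e[OF assms(3)]
    by (simp add: power2_eq_square algebra_simps sum.distrib sum_subtractf sum_distrib_left)
  then show ?thesis by (simp add: L2_set_def)
qed

lemma sqrt_sq_dist_triangle: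
  assumes "finite (set_pmf p)" "finite (set_pmf q)" "finite (set_pmf r)"
  shows "sqrt (sq_dist p r) \<le> sqrt (sq_dist p q) + sqrt (sq_dist q r)"
proof -
  define A where "A = set_pmf p \<union> set_pmf q \<union> set_pmf r"
  have A: "finite A" "set_pmf p \<subseteq> A" "set_pmf q \<subseteq> A" "set_pmf r \<subseteq> A"
    using assms by (auto simp: A_def)
  have "L2_set (\<lambda>x. (pmf p x - pmf q x) + (pmf q x - pmf r x)) A
     \<le> L2_set (\<lambda>x. pmf p x - pmf q x) A + L2_set (\<lambda>x. pmf q x - pmf r x) A"
    by (rule L2_set_triangle_ineq)
  then show ?thesis using A by (simp add: sq_dist_eq_L2_set)
qed

lemma sq_dist_nonneg:
  assumes "finite (set_pmf p)" "finite (set_pmf q)"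
  shows "sq_dist p q \<ge> 0"
proof -
  have "sqrt (sq_dist p q) \<ge> 0"
    using assms by (subst sq_dist_eq_L2_set[of "set_pmf p \<union> set_pmf q"]) auto
  then show ?thesis by simp
qed

text \<open>By log-convexity the ratios \<open>b (2 n + 2) / b (2 n)\<close> increase with \<open>n\<close>, and the first one is at
  least \<open>(b 1 / b 0)\<^sup>2\<close>. For moments of a self-adjoint operator this replaces Jensen's inequality for the
  spectral measure.\<close>

lemma power_le_of_log_convex:
  fixes b :: "nat \<Rightarrow> real"
  assumes "\<And>i. b i \<ge> 0" and "b 0 > 0"
    and cs: "\<And>i j. (b (i + j))\<^sup>2 \<le> b (2 * i) * b (2 * j)"
  shows "b 0 * (b 1 / b 0) ^ (2 * n) \<le> b (2 * n)"
proof (cases "b 1 = 0")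
  case True
  then show ?thesis using assms by (cases n) auto
next
  case False
  define x where "x = (b 1 / b 0)\<^sup>2"
  have x: "x > 0" using False assms(2) by (simp add: x_def)
  have step: "b (2 * n) > 0 \<and> b (2 * Suc n) \<ge> x * b (2 * n)" for n
  proof (induction n)
    case 0
    show ?case using cs[of 0 1] assms(2) by (simp add: x_def power_divide field_simps power2_eq_square)
  next
    case (Suc n)
    then have pos: "b (2 * Suc n) > 0" using x by (meson less_le_trans mult_pos_pos)
    have "b (2 * n) * (x * b (2 * Suc n)) \<le> b (2 * Suc n) * b (2 * Suc n)"
      using Suc pos by (simp add: mult.assoc mult.left_commute)
    also have "\<dots> \<le> b (2 * n) * b (2 * Suc (Suc n))"
      using cs[of n "Suc (Suc n)"]
      by (metis add_Suc_right add_Suc mult_2 power2_eq_square)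
    finally have "x * b (2 * Suc n) \<le> b (2 * Suc (Suc n))" using Suc by simp
    then show ?case using pos by simp
  qed
  have "b 0 * x ^ n \<le> b (2 * n)"
  proof (induction n)
    case (Suc n)
    have "b 0 * x ^ Suc n \<le> x * b (2 * n)" using Suc x by (simp add: mult.left_commute)
    then show ?case using step[of n] by linarith
  qed simp
  then show ?thesis by (simp add: x_def power_mult)
qed

context group
begin

lemma expectation_reflect:
  assumes "set_pmf p \<subseteq> carrier G" "set_pmf q \<subseteq> carrier G"
  shows "measure_pmf.expectation (reflect p) (pmf (reflect q)) = measure_pmf.expectation p (pmf q)"
proof -
  have "measure_pmf.expectation (reflect p) (pmf (reflect q))
      = measure_pmf.expectation p (\<lambda>x. pmf (reflect q) (inv x))"
    by (simp add: reflect_def)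
  also have "\<dots> = measure_pmf.expectation p (pmf q)"
    using assms by (intro integral_cong_AE) (auto simp: AE_measure_pmf_iff pmf_reflect subset_eq)
  finally show ?thesis .
qed

lemma pmf_reflect_convolve_one:
  assumes "set_pmf p \<subseteq> carrier G" "set_pmf q \<subseteq> carrier G"
  shows "pmf (reflect p \<odot> q) \<one> = measure_pmf.expectation p (pmf q)"
  using assms by (simp add: pmf_convolve_one set_reflect expectation_reflect)

text \<open>The autocorrelation of \<open>g\<close>: the \<open>\<ell>\<^sup>2\<close> inner product of \<open>g\<close> with its left translate by \<open>y\<close>. The
  defect \<open>corr g \<one> - corr g y\<close> is half the squared distance of the two.\<close>

definition corr :: "'a pmf \<Rightarrow> 'a \<Rightarrow> real" where
  "corr g y = measure_pmf.expectation g (pmf (map_pmf (\<lambda>x. y \<otimes> x) g))"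

lemma corr_one: "set_pmf g \<subseteq> carrier G \<Longrightarrow> corr g \<one> = measure_pmf.expectation g (pmf g)"
  unfolding corr_def by (subst map_pmf_idI) auto

lemma corr_nonneg: "corr g y \<ge> 0"
  unfolding corr_def by (intro integral_nonneg_AE) simp

lemma corr_bounded: "corr g y \<le> 1"
proof -
  have "corr g y \<le> measure_pmf.expectation g (\<lambda>_. 1)"
    unfolding corr_def
    by (intro integral_mono integrable_measure_pmf_bounded[where B=1]) (auto simp: pmf_le_1)
  then show ?thesis by simp
qed

lemma integrable_corr: "integrable (measure_pmf p) (corr g)"
  by (intro integrable_measure_pmf_bounded[where B=1]) (simp add: corr_nonneg corr_bounded)

lemma pmf_translate_shift:
  assumes "set_pmf p \<subseteq> carrier G" "x \<in> carrier G" "y \<in> carrier G"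
  shows "pmf (map_pmf (\<lambda>z. y \<otimes> z) p) (y \<otimes> x) = pmf p x"
  using assms by (simp add: pmf_translate m_assoc[symmetric])

lemma expectation_translate:
  assumes "set_pmf p \<subseteq> carrier G" "set_pmf q \<subseteq> carrier G" "y \<in> carrier G"
  shows "measure_pmf.expectation (map_pmf (\<lambda>z. y \<otimes> z) p) (pmf (map_pmf (\<lambda>z. y \<otimes> z) q))
    = measure_pmf.expectation p (pmf q)"
proof -
  have "measure_pmf.expectation (map_pmf (\<lambda>z. y \<otimes> z) p) (pmf (map_pmf (\<lambda>z. y \<otimes> z) q))
    = measure_pmf.expectation p (\<lambda>x. pmf (map_pmf (\<lambda>z. y \<otimes> z) q) (y \<otimes> x))" by simp
  also have "\<dots> = measure_pmf.expectation p (pmf q)"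
    using assms by (intro integral_cong_AE) (auto simp: AE_measure_pmf_iff pmf_translate_shift subset_eq)
  finally show ?thesis .
qed

lemma sq_dist_translate:
  assumes "set_pmf g \<subseteq> carrier G" "y \<in> carrier G"
  shows "sq_dist g (map_pmf (\<lambda>x. y \<otimes> x) g) = 2 * (corr g \<one> - corr g y)"
  using assms by (simp add: sq_dist_def expectation_translate corr_one del: integral_map_pmf) (simp add: corr_def)

lemma corr_le_one:
  assumes "set_pmf g \<subseteq> carrier G" "finite (set_pmf g)" "y \<in> carrier G"
  shows "corr g y \<le> corr g \<one>"
  using sq_dist_nonneg[of g "map_pmf (\<lambda>x. y \<otimes> x) g"] assms by (simp add: sq_dist_translate)

text \<open>Translation by \<open>y\<close> is an isometry, so it moves the translate by \<open>z\<close> away from \<open>y\<close> by as much as \<open>z\<close>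
  moves \<open>g\<close>; the triangle inequality in \<open>\<ell>\<^sup>2\<close> does the rest.\<close>

lemma sqrt_corr_defect_subadditive:
  assumes g: "set_pmf g \<subseteq> carrier G" "finite (set_pmf g)" and yz: "y \<in> carrier G" "z \<in> carrier G"
  shows "sqrt (corr g \<one> - corr g (y \<otimes> z)) \<le> sqrt (corr g \<one> - corr g y) + sqrt (corr g \<one> - corr g z)"
proof -
  let ?T = "\<lambda>y. map_pmf (\<lambda>x. y \<otimes> x)"
  have T: "?T (y \<otimes> z) g = ?T y (?T z g)"
    unfolding pmf.map_comp using g yz by (intro pmf.map_cong0) (auto simp: m_assoc)
  have s: "set_pmf (?T z g) \<subseteq> carrier G" using g yz by auto
  have "sq_dist (?T y g) (?T y (?T z g)) = sq_dist g (?T z g)"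
    using g s yz by (simp add: sq_dist_def expectation_translate del: integral_map_pmf)
  moreover have "sqrt (sq_dist g (?T (y \<otimes> z) g)) \<le> sqrt (sq_dist g (?T y g)) + sqrt (sq_dist (?T y g) (?T y (?T z g)))"
    unfolding T using g by (intro sqrt_sq_dist_triangle) auto
  ultimately have "sqrt 2 * sqrt (corr g \<one> - corr g (y \<otimes> z))
      \<le> sqrt 2 * (sqrt (corr g \<one> - corr g y) + sqrt (corr g \<one> - corr g z))"
    using g yz by (simp add: sq_dist_translate real_sqrt_mult distrib_left
        del: right_diff_distrib_numeral)
  then show ?thesis by simp
qed

lemma sqrt_corr_defect_word:
  assumes g: "set_pmf g \<subseteq> carrier G" "finite (set_pmf g)"
    and "\<And>s. s \<in> S \<Longrightarrow> s \<in> carrier G" "\<And>s. s \<in> S \<Longrightarrow> sqrt (corr g \<one> - corr g s) \<le> D"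
    and "set ws \<subseteq> S"
  shows "foldr (\<otimes>) ws \<one> \<in> carrier G
    \<and> sqrt (corr g \<one> - corr g (foldr (\<otimes>) ws \<one>)) \<le> real (length ws) * D"
  using assms(5)
proof (induction ws)
  case (Cons s ws)
  then have s: "s \<in> carrier G" "sqrt (corr g \<one> - corr g s) \<le> D" and w: "foldr (\<otimes>) ws \<one> \<in> carrier G"
    using assms by auto
  have "sqrt (corr g \<one> - corr g (s \<otimes> foldr (\<otimes>) ws \<one>))
    \<le> sqrt (corr g \<one> - corr g s) + sqrt (corr g \<one> - corr g (foldr (\<otimes>) ws \<one>))"
    using sqrt_corr_defect_subadditive[OF g s(1) w] .
  also have "\<dots> \<le> D + real (length ws) * D" using s(2) Cons by auto
  finally show ?case using s(1) w by (simp add: algebra_simps)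
qed simp

text \<open>For symmetric \<open>g\<close> the left-hand side is \<open>\<langle>P g, g\<rangle>\<close> with \<open>P\<close> the convolution by \<open>\<psi>\<close>.\<close>

lemma pmf_sandwich:
  assumes "set_pmf g \<subseteq> carrier G" "reflect g = g" "set_pmf \<psi> \<subseteq> carrier G"
  shows "pmf (g \<odot> (\<psi> \<odot> g)) \<one> = measure_pmf.expectation \<psi> (corr g)"
proof -
  have "g \<odot> (\<psi> \<odot> g) = bind_pmf \<psi> (\<lambda>y. g \<odot> map_pmf (\<lambda>x. y \<otimes> x) g)"
    unfolding convolve_bind map_bind_pmf by (rule bind_commute_pmf)
  then have "pmf (g \<odot> (\<psi> \<odot> g)) \<one> = measure_pmf.expectation \<psi> (\<lambda>y. pmf (g \<odot> map_pmf (\<lambda>x. y \<otimes> x) g) \<one>)"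
    by (simp add: pmf_bind)
  also have "\<dots> = measure_pmf.expectation \<psi> (corr g)"
  proof (intro integral_cong_AE)
    show "AE y in \<psi>. pmf (g \<odot> map_pmf (\<lambda>x. y \<otimes> x) g) \<one> = corr g y"
      unfolding AE_measure_pmf_iff
    proof
      fix y assume "y \<in> set_pmf \<psi>"
      then have "set_pmf (map_pmf (\<lambda>x. y \<otimes> x) g) \<subseteq> carrier G" using assms by auto
      from pmf_reflect_convolve_one[OF assms(1) this]
      show "pmf (g \<odot> map_pmf (\<lambda>x. y \<otimes> x) g) \<one> = corr g y" by (simp add: assms(2) corr_def)
    qed
  qed auto
  finally show ?thesis .
qed

text \<open>Symmetry of \<open>\<phi>\<close> makes \<open>b (i + j)\<close> the inner product of the convolutions of \<open>\<phi>^(i)\<close> and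
  \<open>\<phi>^(j)\<close> with \<open>g\<close>.\<close>

lemma sandwich_Cauchy_Schwarz:
  assumes "symmetric_prob G g" "symmetric_prob G \<phi>"
  defines "b \<equiv> \<lambda>m. pmf (g \<odot> (conv_power G \<phi> m \<odot> g)) \<one>"
  shows "(b (i + j))\<^sup>2 \<le> b (2 * i) * b (2 * j)"
proof -
  have s: "set_pmf g \<subseteq> carrier G" "set_pmf \<phi> \<subseteq> carrier G" "reflect g = g"
    using assms by (auto simp: symmetric_prob_iff_reflect)
  define v where "v m = conv_power G \<phi> m \<odot> g" for m
  have v: "set_pmf (v m) \<subseteq> carrier G" for m
    using s by (simp add: v_def set_convolve set_conv_power)
  have r: "reflect (v m) = g \<odot> conv_power G \<phi> m" for m
    using s assms(2) by (simp add: v_def reflect_convolve reflect_conv_power set_conv_power)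
  have b: "b (i + j) = measure_pmf.expectation (v i) (pmf (v j))" for i j
  proof -
    have "g \<odot> (conv_power G \<phi> (i + j) \<odot> g) = reflect (v i) \<odot> v j"
      unfolding r unfolding v_def using s
      by (simp add: convolve_assoc conv_power_add set_conv_power set_convolve)
    then show ?thesis
      unfolding pmf_reflect_convolve_one[OF v v, symmetric] by (simp add: b_def)
  qed
  show ?thesis
    using pmf_Cauchy_Schwarz[of "v i" "v j"] by (simp add: b mult_2)
qed

text \<open>The left-hand side is the inner product of \<open>\<phi>^(n)\<close> with one of its translates, and the right-hand side
  is its squared norm.\<close>

lemma even_conv_power_le_one:
  assumes "symmetric_prob G \<phi>" "z \<in> carrier G"
  shows "pmf (conv_power G \<phi> (2 * n)) z \<le> pmf (conv_power G \<phi> (2 * n)) \<one>"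
proof -
  have s: "set_pmf \<phi> \<subseteq> carrier G" using assms by (auto simp: symmetric_prob_iff_reflect)
  define p where "p = conv_power G \<phi> n"
  have p: "set_pmf p \<subseteq> carrier G" "reflect p = p"
    using s assms reflect_conv_power by (auto simp: p_def set_conv_power)
  have pp: "conv_power G \<phi> (2 * n) = p \<odot> p" using s by (simp add: p_def mult_2 conv_power_add)
  define q where "q = map_pmf (\<lambda>x. z \<otimes> x) p"
  have q: "set_pmf q \<subseteq> carrier G" using p assms by (auto simp: q_def)
  have "pmf (p \<odot> p) z = measure_pmf.expectation p (\<lambda>x. pmf q x)"
  proof -
    have "pmf (p \<odot> p) z = measure_pmf.expectation p (\<lambda>x. pmf p (inv x \<otimes> z))"
      using p assms by (simp add: pmf_convolve)
    also have "\<dots> = measure_pmf.expectation p (pmf q)"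
    proof (intro integral_cong_AE)
      show "AE x in p. pmf p (inv x \<otimes> z) = pmf q x"
        unfolding AE_measure_pmf_iff
      proof
        fix x assume "x \<in> set_pmf p"
        then have x: "x \<in> carrier G" using p by auto
        have "pmf q x = pmf p (inv z \<otimes> x)" using x p assms by (simp add: q_def pmf_translate)
        also have "\<dots> = pmf (reflect p) (inv z \<otimes> x)" by (simp add: p)
        also have "\<dots> = pmf p (inv x \<otimes> z)" using x p(1) assms by (simp add: pmf_reflect inv_mult_group)
        finally show "pmf p (inv x \<otimes> z) = pmf q x" by simp
      qed
    qed auto
    finally show ?thesis .
  qed
  moreover have "(measure_pmf.expectation p (pmf q))\<^sup>2 \<le> (measure_pmf.expectation p (pmf p))\<^sup>2"
    using pmf_Cauchy_Schwarz[of p q] p assms(2)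
    by (simp add: q_def expectation_translate power2_eq_square del: integral_map_pmf)
  moreover have "0 \<le> measure_pmf.expectation p (pmf p)" by (intro integral_nonneg_AE) simp
  moreover have "pmf (p \<odot> p) \<one> = measure_pmf.expectation p (pmf p)"
    using pmf_reflect_convolve_one[OF p(1) p(1)] p by simp
  ultimately show ?thesis using pp power2_le_imp_le by metis
qed

text \<open>The quotient is the Rayleigh quotient \<open>\<langle>P g, g\<rangle> / \<langle>g, g\<rangle>\<close>. Log-convexity bounds \<open>\<langle>P^(2n) g, g\<rangle>\<close> from
  below; from above it is an average of values of \<open>\<phi>^(2n)\<close>, the largest of which is at the identity.\<close>

lemma return_prob_ge_test_function:
  assumes g: "symmetric_prob G g" and \<phi>: "symmetric_prob G \<phi>"
    and pos: "corr g \<one> > 0"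
  shows "corr g \<one> * (measure_pmf.expectation \<phi> (corr g) / corr g \<one>) ^ (2 * n)
    \<le> pmf (conv_power G \<phi> (2 * n)) \<one>"
proof -
  have s: "set_pmf g \<subseteq> carrier G" "set_pmf \<phi> \<subseteq> carrier G" "reflect g = g"
    using assms by (auto simp: symmetric_prob_iff_reflect)
  define b where "b m = pmf (g \<odot> (conv_power G \<phi> m \<odot> g)) \<one>" for m
  have b0: "b 0 = corr g \<one>"
    using s pmf_reflect_convolve_one[OF s(1) s(1)] by (simp add: b_def convolve_one_left corr_one)
  have b1: "b 1 = measure_pmf.expectation \<phi> (corr g)"
    using s by (simp add: b_def convolve_one_right pmf_sandwich)
  have "b 0 * (b 1 / b 0) ^ (2 * n) \<le> b (2 * n)"
    using sandwich_Cauchy_Schwarz[OF g \<phi>] pos b0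
    by (intro power_le_of_log_convex) (auto simp: b_def)
  also have "\<dots> \<le> pmf (conv_power G \<phi> (2 * n)) \<one>"
    unfolding b_def using s even_conv_power_le_one[OF \<phi>]
    by (intro pmf_convolve_le_right pmf_convolve_le_left) (auto simp: set_convolve set_conv_power)
  finally show ?thesis by (simp only: b0 b1)
qed

end

section \<open>Slow decay and truncated second moments\<close>

lemma pmf_mult_le_expectation:
  fixes f :: "'a \<Rightarrow> real"
  assumes "\<And>y. 0 \<le> f y" "\<And>y. f y \<le> B"
  shows "pmf p x * f x \<le> measure_pmf.expectation p f"
proof -
  have "pmf p x * f x = measure_pmf.expectation p (\<lambda>y. f x * indicator {x} y)"
    by (simp add: measure_pmf_single)
  also have "\<dots> \<le> measure_pmf.expectation p f"
    using assms
    by (intro integral_mono integrable_measure_pmf_bounded[where B="\<bar>f x\<bar>"]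
        integrable_measure_pmf_bounded[where B=B])
       (auto simp: indicator_def)
  finally show ?thesis .
qed

text \<open>If every step lost more than the fraction \<open>A / K\<close>, then \<open>K\<close> steps would lose more than a factor
  \<open>exp (- A)\<close>.\<close>

lemma exists_slow_decay:
  fixes a :: "nat \<Rightarrow> real"
  assumes "antimono a" "a 0 \<le> 1" "exp (- A) \<le> a K" "K > 0"
  shows "\<exists>k<K. exp (- A) \<le> a k \<and> a k - a (Suc k) \<le> A / K * a k"
proof (rule ccontr)
  assume neg: "\<not> ?thesis"
  have ge: "exp (- A) \<le> a k" if "k \<le> K" for k
    using antimonoD[OF assms(1) that] assms(3) by simp
  have less: "a (Suc k) < exp (- A / K) * a k" if "k < K" for k
  proof -
    have "a (Suc k) < (1 - A / K) * a k"
      using neg ge[of k] that by (auto simp: algebra_simps not_le)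
    also have "\<dots> \<le> exp (- A / K) * a k"
      using exp_ge_add_one_self[of "- A / K"] ge[of k] that
      by (intro mult_right_mono) (auto intro: order_trans[OF exp_ge_zero])
    finally show ?thesis .
  qed
  have le: "a j \<le> exp (- A / K) ^ j" if "j \<le> K" for j
    using that
  proof (induction j)
    case (Suc j)
    have "a (Suc j) < exp (- A / K) * a j" using less Suc by simp
    also have "\<dots> \<le> exp (- A / K) * exp (- A / K) ^ j"
      using Suc by (intro mult_left_mono) auto
    finally show ?case by simp
  qed (use assms in simp)
  obtain j where j: "K = Suc j" using assms(4) by (cases K) auto
  have "a K < exp (- A / K) * a j" using less[of j] j by simp
  also have "\<dots> \<le> exp (- A / K) * exp (- A / K) ^ j"
    using le[of j] j by (intro mult_left_mono) auto
  also have "\<dots> = exp (- A / K) ^ K" by (simp add: j)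
  also have "\<dots> = exp (- A)"
    using assms(4) by (simp add: exp_of_nat_mult[symmetric])
  finally show False using assms(3) by simp
qed

context
  fixes \<rho> :: "real \<Rightarrow> real"
  assumes cont: "continuous_on {0..} \<rho>" and mono: "mono_on {0..} \<rho>" and ge1: "\<And>t. t \<ge> 0 \<Longrightarrow> \<rho> t \<ge> 1"
begin

lemma integrable_ratio: "0 \<le> a \<Longrightarrow> (\<lambda>s. s / \<rho> s) integrable_on {a..b}"
proof (intro integrable_continuous_real continuous_on_divide continuous_on_id)
  assume "0 \<le> a"
  then show "continuous_on {a..b} \<rho>" by (intro continuous_on_subset[OF cont]) auto
  show "\<forall>x\<in>{a..b}. \<rho> x \<noteq> 0"
  proof
    fix x assume "x \<in> {a..b}"
    then show "\<rho> x \<noteq> 0" using \<open>0 \<le> a\<close> ge1[of x] by auto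
  qed
qed

text \<open>On \<open>[k - 1, k]\<close> the function \<open>\<rho>\<close> is at most \<open>\<rho> k\<close>, and \<open>s\<close> has integral \<open>(2 k - 1) / 2\<close>.\<close>

lemma sum_le_integral_ratio:
  "(\<Sum>k=1..r. real (2 * k - 1) / \<rho> (real k)) \<le> 2 * integral {0..real r} (\<lambda>s. s / \<rho> s)"
proof (induction r)
  case (Suc r)
  have pos: "\<rho> (real (Suc r)) > 0" using ge1[of "real (Suc r)"] by linarith
  have i: "((\<lambda>s. s / \<rho> (real (Suc r))) has_integral ((real (Suc r))\<^sup>2 - (real r)\<^sup>2) / 2 / \<rho> (real (Suc r)))
      {real r..real (Suc r)}"
    by (intro has_integral_divide ident_has_integral) simp
  have step: "((real (Suc r))\<^sup>2 - (real r)\<^sup>2) / 2 / \<rho> (real (Suc r))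
    \<le> integral {real r..real (Suc r)} (\<lambda>s. s / \<rho> s)"
  proof (rule has_integral_le[OF i integrable_integral[OF integrable_ratio]])
    fix s assume s: "s \<in> {real r..real (Suc r)}"
    then have "0 \<le> s" by (auto intro: order_trans[of 0 "real r"])
    moreover have "\<rho> s \<le> \<rho> (real (Suc r))" using s \<open>0 \<le> s\<close> by (intro mono_onD[OF mono]) auto
    moreover have "\<rho> s > 0" using ge1[OF \<open>0 \<le> s\<close>] by linarith
    ultimately show "s / \<rho> (real (Suc r)) \<le> s / \<rho> s" by (intro divide_left_mono) auto
  qed simp
  have comb: "integral {0..real r} (\<lambda>s. s / \<rho> s) + integral {real r..real (Suc r)} (\<lambda>s. s / \<rho> s)
      = integral {0..real (Suc r)} (\<lambda>s. s / \<rho> s)"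
    by (intro Henstock_Kurzweil_Integration.integral_combine integrable_ratio) auto
  have "real (2 * Suc r - 1) / \<rho> (real (Suc r))
      = 2 * (((real (Suc r))\<^sup>2 - (real r)\<^sup>2) / 2 / \<rho> (real (Suc r)))"
    using pos by (simp add: power2_eq_square field_simps)
  then have "(\<Sum>k=1..Suc r. real (2 * k - 1) / \<rho> (real k))
      = (\<Sum>k=1..r. real (2 * k - 1) / \<rho> (real k))
        + 2 * (((real (Suc r))\<^sup>2 - (real r)\<^sup>2) / 2 / \<rho> (real (Suc r)))"
    by simp
  also have "\<dots> \<le> 2 * integral {0..real r} (\<lambda>s. s / \<rho> s)
      + 2 * integral {real r..real (Suc r)} (\<lambda>s. s / \<rho> s)"
    by (intro add_mono Suc mult_left_mono step) simp
  also have "\<dots> = 2 * integral {0..real (Suc r)} (\<lambda>s. s / \<rho> s)"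
    unfolding comb[symmetric] by (rule distrib_left[symmetric])
  finally show ?case .
qed simp

text \<open>The weak moment controls the event \<open>\<rho> |y| > s\<close> with strict inequality; as \<open>\<rho>\<close> may be constant on
  intervals, the bound at the level \<open>\<rho> k\<close> is the limit of those at \<open>s < \<rho> k\<close>.\<close>

lemma weak_moment_tail:
  assumes "weak_moment G S \<rho> \<phi> \<le> ennreal (2 * \<rho> 0)" "set_pmf \<phi> \<subseteq> carrier G"
  shows "measure_pmf.prob \<phi> {y. k \<le> word_length G S y} \<le> 2 * \<rho> 0 / \<rho> (real k)"
proof -
  define P where "P = measure_pmf.prob \<phi> {y. k \<le> word_length G S y}"
  have pos: "\<rho> (real k) > 0" using ge1[of "real k"] by linarith
  have "s * P \<le> 2 * \<rho> 0" if s: "0 < s" "s < \<rho> (real k)" for s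
  proof -
    let ?X = "{g \<in> carrier G. \<rho> (real (word_length G S g)) > s}"
    have "ennreal (s * measure_pmf.prob \<phi> ?X) \<le> weak_moment G S \<rho> \<phi>"
      unfolding weak_moment_def using s by (intro SUP_upper) auto
    also have "\<dots> \<le> ennreal (2 * \<rho> 0)" by (fact assms)
    finally have "s * measure_pmf.prob \<phi> ?X \<le> 2 * \<rho> 0"
      using ge1[of 0] by (simp add: ennreal_le_iff)
    moreover have "P \<le> measure_pmf.prob \<phi> ?X"
      unfolding P_def
    proof (rule measure_pmf.finite_measure_mono_AE)
      show "AE y in \<phi>. y \<in> {y. k \<le> word_length G S y} \<longrightarrow> y \<in> ?X"
        unfolding AE_measure_pmf_iff
      proof (intro ballI impI)
        fix y assume y: "y \<in> set_pmf \<phi>" "y \<in> {y. k \<le> word_length G S y}"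
        then have "\<rho> (real k) \<le> \<rho> (real (word_length G S y))" by (intro mono_onD[OF mono]) auto
        then show "y \<in> ?X" using y s assms by auto
      qed
    qed auto
    ultimately show ?thesis using s by (meson less_imp_le mult_left_mono order_trans)
  qed
  note * = this
  have "\<rho> (real k) * P \<le> 2 * \<rho> 0"
  proof (rule field_le_mult_one_interval)
    fix z :: real assume z: "0 < z" "z < 1"
    show "z * (\<rho> (real k) * P) \<le> 2 * \<rho> 0"
      using *[of "z * \<rho> (real k)"] z pos by (simp add: mult.assoc)
  qed
  then show ?thesis using pos by (simp add: P_def field_simps)
qed

lemma min_square_eq_sum:
  "(real (min m r))\<^sup>2 = (\<Sum>k=1..r. real (2 * k - 1) * indicator {k. k \<le> m} k)"
proof (induction r)
  case (Suc r)
  show ?case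
  proof (cases "Suc r \<le> m")
    case True
    then have "min m (Suc r) = Suc r" "min m r = r" by auto
    then show ?thesis using Suc True by (simp add: power2_eq_square algebra_simps)
  qed (use Suc in \<open>simp add: min_def split: if_splits\<close>)
qed simp

text \<open>Summation by parts: write the square as a sum of odd numbers and use the tail bound.\<close>

lemma truncated_second_moment_le:
  assumes "weak_moment G S \<rho> \<phi> \<le> ennreal (2 * \<rho> 0)" "set_pmf \<phi> \<subseteq> carrier G"
  shows "measure_pmf.expectation \<phi> (\<lambda>y. (real (min (word_length G S y) r))\<^sup>2)
     \<le> 4 * \<rho> 0 * integral {0..real r} (\<lambda>s. s / \<rho> s)"
proof -
  have "measure_pmf.expectation \<phi> (\<lambda>y. (real (min (word_length G S y) r))\<^sup>2)
    = measure_pmf.expectation \<phi> (\<lambda>y. \<Sum>k=1..r. real (2 * k - 1) * indicator {y. k \<le> word_length G S y} y)"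
    by (simp add: min_square_eq_sum indicator_def)
  also have "\<dots> = (\<Sum>k=1..r. real (2 * k - 1) * measure_pmf.prob \<phi> {y. k \<le> word_length G S y})"
  proof (subst Bochner_Integration.integral_sum)
    fix k
    show "integrable \<phi> (\<lambda>y. real (2 * k - 1) * indicator {y. k \<le> word_length G S y} y)"
      by (intro integrable_measure_pmf_bounded[where B="real (2 * k - 1)"]) (simp add: indicator_def)
  qed simp
  also have "\<dots> \<le> (\<Sum>k=1..r. real (2 * k - 1) * (2 * \<rho> 0 / \<rho> (real k)))"
    using weak_moment_tail[OF assms] by (intro sum_mono mult_left_mono) auto
  also have "\<dots> = 2 * \<rho> 0 * (\<Sum>k=1..r. real (2 * k - 1) / \<rho> (real k))"
    by (simp add: sum_distrib_left mult_ac)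
  also have "\<dots> \<le> 2 * \<rho> 0 * (2 * integral {0..real r} (\<lambda>s. s / \<rho> s))"
    using ge1[of 0] sum_le_integral_ratio[of r] by (intro mult_left_mono) auto
  finally show ?thesis by simp
qed

end

context group
begin

lemma foldr_mult_closed: "set ws \<subseteq> carrier G \<Longrightarrow> foldr (\<otimes>) ws \<one> \<in> carrier G"
  by (induction ws) auto

lemma foldr_mult_start:
  assumes "set ws \<subseteq> carrier G" "z \<in> carrier G"
  shows "foldr (\<otimes>) ws z = foldr (\<otimes>) ws \<one> \<otimes> z"
  using assms(1) by (induction ws) (use assms(2) in \<open>auto simp: m_assoc foldr_mult_closed\<close>)

lemma foldr_mult_inv:
  assumes "set ws \<subseteq> carrier G"
  shows "foldr (\<otimes>) (map (\<lambda>x. inv x) (rev ws)) \<one> = inv (foldr (\<otimes>) ws \<one>)"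
  using assms
proof (induction ws)
  case (Cons w ws)
  have "set (map (\<lambda>x. inv x) (rev ws)) \<subseteq> carrier G" using Cons by auto
  then show ?case using Cons foldr_mult_start[of "map (\<lambda>x. inv x) (rev ws)" "inv w"]
    by (simp add: foldr_mult_closed inv_mult_group)
qed simp

lemma generating_word:
  assumes S: "symmetric_generating_set G S" and "y \<in> carrier G"
  shows "\<exists>ws. set ws \<subseteq> S \<and> foldr (\<otimes>) ws \<one> = y"
proof -
  have sub: "S \<subseteq> carrier G" using S by (simp add: symmetric_generating_set_def)
  have "y \<in> generate G S" using S assms(2) by (simp add: symmetric_generating_set_def)
  then show ?thesis
  proof (induction rule: generate.induct)
    case one
    show ?case by (rule exI[of _ "[]"]) simp
  next
    case (incl h)
    then show ?case using sub by (intro exI[of _ "[h]"]) auto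
  next
    case (inv h)
    then show ?case using S sub by (intro exI[of _ "[inv h]"]) (auto simp: symmetric_generating_set_def)
  next
    case (eng h1 h2)
    then obtain ws vs where "set ws \<subseteq> S" "foldr (\<otimes>) ws \<one> = h1" "set vs \<subseteq> S" "foldr (\<otimes>) vs \<one> = h2"
      by blast
    then show ?case using sub foldr_mult_start[of ws "foldr (\<otimes>) vs \<one>"] foldr_mult_closed[of vs]
      by (intro exI[of _ "ws @ vs"]) auto
  qed
qed

lemma geodesic_word:
  assumes "symmetric_generating_set G S" "y \<in> carrier G"
  obtains ws where "length ws = word_length G S y" "set ws \<subseteq> S" "foldr (\<otimes>) ws \<one> = y"
proof -
  have "\<exists>n ws. length ws = n \<and> set ws \<subseteq> S \<and> foldr (\<otimes>) ws \<one> = y"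
    using generating_word[OF assms] by auto
  from LeastI_ex[OF this] show ?thesis using that unfolding word_length_def by blast
qed

lemma word_length_le:
  assumes "set ws \<subseteq> S" "foldr (\<otimes>) ws \<one> = y"
  shows "word_length G S y \<le> length ws"
  unfolding word_length_def using assms by (intro Least_le) auto

lemma symmetric_prob_uniform:
  assumes "finite B" "B \<noteq> {}" "B \<subseteq> carrier G" "\<And>s. s \<in> B \<Longrightarrow> inv s \<in> B"
  shows "symmetric_prob G (pmf_of_set B)"
proof -
  have "inv x \<in> B \<longleftrightarrow> x \<in> B" if "x \<in> carrier G" for x
    using assms(4)[of x] assms(4)[of "inv x"] that by auto
  then show ?thesis using assms by (auto simp: symmetric_prob_def indicator_def)
qed

context
  fixes S assumes S: "symmetric_generating_set G S"
begin

lemma generators: "finite S" "S \<noteq> {}" "S \<subseteq> carrier G" "\<one> \<in> S" "\<And>s. s \<in> S \<Longrightarrow> inv s \<in> S"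
  using S by (auto simp: symmetric_generating_set_def)

abbreviation (input) "walk k \<equiv> conv_power G (pmf_of_set S) k"

lemma walk: "set_pmf (walk k) \<subseteq> carrier G" "reflect (walk k) = walk k" "symmetric_prob G (walk k)"
  "finite (set_pmf (walk k))"
proof -
  have u: "symmetric_prob G (pmf_of_set S)" using symmetric_prob_uniform generators by blast
  then show "set_pmf (walk k) \<subseteq> carrier G" "reflect (walk k) = walk k"
    by (auto simp: set_conv_power reflect_conv_power symmetric_prob_iff_reflect)
  then show "symmetric_prob G (walk k)" by (simp add: symmetric_prob_iff_reflect)
  show "finite (set_pmf (walk k))"
    by (induction k) (auto simp: convolve_bind generators)
qed

lemma walk_support: "set_pmf (pmf_of_set S) \<subseteq> carrier G"
  using generators by simp

text \<open>With \<open>a\<^sub>k\<close> the return probability after \<open>2 k\<close> steps, this and the next lemma say that \<open>\<langle>g, g\<rangle> = a\<^sub>k\<close> and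
  that the average of the autocorrelation over two steps of the walk is \<open>a\<^sub>k\<^sub>+\<^sub>1\<close>. Thus decay of return
  probabilities measures how far the walk moves \<open>g\<close>.\<close>

lemma corr_walk_one: "corr (walk k) \<one> = return_prob G S (2 * k)"
proof -
  have "corr (walk k) \<one> = pmf (walk k \<odot> walk k) \<one>"
    using pmf_reflect_convolve_one[OF walk(1) walk(1)] walk(2) by (simp add: corr_one walk(1))
  also have "walk k \<odot> walk k = walk (2 * k)"
    by (simp add: mult_2 conv_power_add generators)
  finally show ?thesis by (simp add: return_prob_def)
qed

lemma expectation_corr_walk:
  "measure_pmf.expectation (walk 2) (corr (walk k)) = return_prob G S (2 * Suc k)"
proof -
  have "walk k \<odot> (walk 2 \<odot> walk k) = walk (k + (2 + k))"
    by (simp only: conv_power_add walk_support)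
  also have "k + (2 + k) = 2 * Suc k" by simp
  finally show ?thesis using pmf_sandwich[OF walk(1) walk(2) walk(1), of k 2]
    by (simp add: return_prob_def)
qed

text \<open>A generator \<open>s\<close> is the two-step product \<open>\<one> \<otimes> s\<close>. Two steps are used because only even return
  probabilities are squared norms.\<close>

lemma walk_2_ge:
  assumes "s \<in> S"
  shows "1 / (real (card S))\<^sup>2 \<le> pmf (walk 2) s"
proof -
  have s: "s \<in> carrier G" using assms generators by auto
  have "walk 2 = pmf_of_set S \<odot> pmf_of_set S"
    using generators by (simp add: numeral_2_eq_2 convolve_one_right)
  then have "pmf (walk 2) s = measure_pmf.expectation (pmf_of_set S) (\<lambda>x. pmf (pmf_of_set S) (inv x \<otimes> s))"
    using generators s by (simp add: pmf_convolve)
  also have "\<dots> \<ge> pmf (pmf_of_set S) \<one> * pmf (pmf_of_set S) (inv \<one> \<otimes> s)"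
    by (intro pmf_mult_le_expectation[where B=1 and f="\<lambda>x. pmf (pmf_of_set S) (inv x \<otimes> s)"])
       (simp_all add: pmf_le_1)
  also have "pmf (pmf_of_set S) \<one> * pmf (pmf_of_set S) (inv \<one> \<otimes> s) = 1 / (real (card S))\<^sup>2"
    using generators assms s by (simp add: power2_eq_square)
  finally show ?thesis by simp
qed

text \<open>All defects are nonnegative, so the one at \<open>s\<close> is at most the average defect over two steps, divided by
  the probability of \<open>s\<close>.\<close>

lemma corr_defect_generator:
  assumes "s \<in> S"
  shows "corr (walk k) \<one> - corr (walk k) s
    \<le> (real (card S))\<^sup>2 * (return_prob G S (2 * k) - return_prob G S (2 * Suc k))"
proof -
  let ?g = "walk k"
  \<comment> \<open>Off the carrier the defect need not be nonnegative; the measure does not see these points.\<close>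
  define f where "f y = (if y \<in> carrier G then corr ?g \<one> - corr ?g y else 0)" for y
  have f: "0 \<le> f y" "f y \<le> corr ?g \<one>" for y
    using corr_le_one[OF walk(1,4)] by (auto simp: f_def corr_nonneg)
  have ic: "integrable (walk 2) (corr ?g)" by (rule integrable_corr)
  have s: "s \<in> carrier G" using assms generators by auto
  have "1 / (real (card S))\<^sup>2 * f s \<le> pmf (walk 2) s * f s"
    using f walk_2_ge[OF assms] by (intro mult_right_mono)
  also have "\<dots> \<le> measure_pmf.expectation (walk 2) f"
    by (intro pmf_mult_le_expectation[where B="corr ?g \<one>"] f)
  also have "\<dots> = measure_pmf.expectation (walk 2) (\<lambda>y. corr ?g \<one> - corr ?g y)"
    using walk(1)[of 2] by (intro integral_cong_AE) (auto simp: AE_measure_pmf_iff f_def)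
  also have "\<dots> = return_prob G S (2 * k) - return_prob G S (2 * Suc k)"
    using ic by (subst Bochner_Integration.integral_diff)
       (simp_all only: expectation_corr_walk corr_walk_one, simp_all)
  finally have "1 / (real (card S))\<^sup>2 * f s \<le> return_prob G S (2 * k) - return_prob G S (2 * Suc k)" .
  moreover have "card S > 0" using generators by (simp add: card_gt_0_iff)
  ultimately show ?thesis using s by (simp add: f_def field_simps)
qed

lemma return_prob_antimono: "antimono (\<lambda>k. return_prob G S (2 * k))"
proof (rule decseq_SucI)
  fix k
  have "0 \<le> (real (card S))\<^sup>2 * (return_prob G S (2 * k) - return_prob G S (2 * Suc k))"
    using corr_defect_generator[OF generators(4), of k] by simp
  moreover have "card S > 0" using generators by (simp add: card_gt_0_iff)
  ultimately show "return_prob G S (2 * Suc k) \<le> return_prob G S (2 * k)"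
    by (simp add: zero_le_mult_iff)
qed

lemma corr_defect:
  assumes y: "y \<in> carrier G"
  shows "corr (walk k) \<one> - corr (walk k) y \<le> (real (word_length G S y))\<^sup>2 *
     ((real (card S))\<^sup>2 * (return_prob G S (2 * k) - return_prob G S (2 * Suc k)))"
proof -
  define D where "D = (real (card S))\<^sup>2 * (return_prob G S (2 * k) - return_prob G S (2 * Suc k))"
  have D: "D \<ge> 0" using corr_defect_generator[OF generators(4), of k] by (simp add: D_def)
  obtain ws where ws: "length ws = word_length G S y" "set ws \<subseteq> S" "foldr (\<otimes>) ws \<one> = y"
    using geodesic_word[OF S y] .
  have "sqrt (corr (walk k) \<one> - corr (walk k) y) \<le> real (word_length G S y) * sqrt D"
    using sqrt_corr_defect_word[OF walk(1,4)[of k], of S "sqrt D" ws] ws generators corr_defect_generator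
    by (auto simp: D_def subset_eq)
  then have "(sqrt (corr (walk k) \<one> - corr (walk k) y))\<^sup>2 \<le> (real (word_length G S y) * sqrt D)\<^sup>2"
    using corr_le_one[OF walk(1,4) y, of k] by (intro power_mono) auto
  then show ?thesis
    using corr_le_one[OF walk(1,4) y, of k] D by (simp add: power_mult_distrib D_def)
qed

end
end

section \<open>Two-sided bounds for the extremal return probability\<close>

lemma exp_le_one_minus_power:
  fixes x :: real
  assumes "0 \<le> x" "x \<le> 1 / 2"
  shows "exp (- (2 * real m * x)) \<le> (1 - x) ^ m"
proof -
  have "- x - 2 * x\<^sup>2 \<le> ln (1 - x)" using assms by (intro ln_one_minus_pos_lower_bound) auto
  moreover have "2 * x\<^sup>2 \<le> x" using assms mult_right_mono[of x "1 / 2" x] by (simp add: power2_eq_square)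
  ultimately have "- (2 * x) \<le> ln (1 - x)" by linarith
  then have "exp (- (2 * x)) \<le> 1 - x" using assms by (subst (asm) ln_ge_iff) auto
  then have "exp (- (2 * x)) ^ m \<le> (1 - x) ^ m" by (intro power_mono) auto
  then show ?thesis by (simp add: exp_of_nat_mult[symmetric] mult_ac)
qed

context group
begin

context
  fixes S assumes S: "symmetric_generating_set G S"
begin

context
  fixes \<rho> :: "real \<Rightarrow> real"
  assumes cont: "continuous_on {0..} \<rho>" and mono: "mono_on {0..} \<rho>" and ge1: "\<And>t. t \<ge> 0 \<Longrightarrow> \<rho> t \<ge> 1"
begin

text \<open>The test function is a power of the walk at a time of slow decay. Its defects are at most
  \<open>M (|y| / r)\<^sup>2\<close> relative to \<open>\<langle>g, g\<rangle>\<close>, and at most 1 as correlations are nonnegative; with \<open>M \<ge> 1\<close> both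
  bounds follow from the one with \<open>|y|\<close> truncated at \<open>r\<close>, which has a finite average under \<open>\<phi>\<close>.\<close>

lemma return_prob_lower_bound:
  assumes \<phi>: "symmetric_prob G \<phi>" "weak_moment G S \<rho> \<phi> \<le> ennreal (2 * \<rho> 0)"
    and r: "r > 0" and A: "exp (- A * real r) \<le> return_prob G S (2 * r ^ 3)"
  defines "M \<equiv> max 1 ((real (card S))\<^sup>2 * A)"
  defines "x \<equiv> 4 * M * \<rho> 0 * (integral {0..real r} (\<lambda>s. s / \<rho> s) / (real r)\<^sup>2)"
  assumes x: "x \<le> 1 / 2"
  shows "exp (- (A * real r + 4 * real n * x)) \<le> pmf (conv_power G \<phi> (2 * n)) \<one>"
proof -
  define R where "R k = return_prob G S (2 * k)" for k
  have R0: "R 0 \<le> 1" by (simp add: R_def return_prob_def pmf_le_1)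
  obtain k where k: "exp (- A * real r) \<le> R k" "R k - R (Suc k) \<le> A * real r / real (r ^ 3) * R k"
  proof -
    have "antimono R" using return_prob_antimono[OF S] by (simp add: R_def[abs_def])
    moreover have "exp (- (A * real r)) \<le> R (r ^ 3)" using A by (simp add: R_def)
    ultimately show ?thesis
      using exists_slow_decay[of R "A * real r" "r ^ 3"] R0 r that by auto
  qed
  define g where "g = walk S k"
  have g: "set_pmf g \<subseteq> carrier G" "finite (set_pmf g)" "symmetric_prob G g"
    using walk[OF S] by (auto simp: g_def)
  have a: "corr g \<one> = R k" by (simp add: g_def R_def corr_walk_one[OF S])
  have pos: "R k > 0" using k(1) by (meson exp_gt_zero less_le_trans)
  have M: "M \<ge> 1" "(real (card S))\<^sup>2 * A \<le> M" by (auto simp: M_def)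
  define h where "h y = (real (min (word_length G S y) r))\<^sup>2 / (real r)\<^sup>2" for y
  have h: "0 \<le> h y" "h y \<le> 1" for y
    using r by (auto simp: h_def divide_le_eq_1 power_mono)
  have s: "set_pmf \<phi> \<subseteq> carrier G" using \<phi>(1) by (simp add: symmetric_prob_def)
  have defect: "corr g y \<ge> R k * (1 - M * h y)" if y: "y \<in> carrier G" for y
  proof (cases "word_length G S y \<le> r")
    case True
    have "corr g \<one> - corr g y \<le> (real (word_length G S y))\<^sup>2 * ((real (card S))\<^sup>2 * (R k - R (Suc k)))"
      using corr_defect[OF S y, of k] by (simp add: g_def R_def)
    also have "\<dots> \<le> (real (word_length G S y))\<^sup>2 * ((real (card S))\<^sup>2 * (A * real r / real (r ^ 3) * R k))"
      using k by (intro mult_left_mono) auto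
    also have "\<dots> = ((real (card S))\<^sup>2 * A) * (h y * R k)"
      using True r by (simp add: h_def field_simps power2_eq_square power3_eq_cube)
    also have "\<dots> \<le> M * (h y * R k)"
      using M h pos by (intro mult_right_mono) auto
    finally show ?thesis by (simp add: a algebra_simps)
  next
    case False
    then have "h y = 1" using r by (simp add: h_def)
    then have "R k * (1 - M * h y) \<le> 0" using M pos by (simp add: mult_le_0_iff)
    then show ?thesis using corr_nonneg[of g y] by linarith
  qed
  have ih: "integrable \<phi> h" using h by (intro integrable_measure_pmf_bounded[where B=1]) auto
  have Eh: "M * measure_pmf.expectation \<phi> h \<le> x"
  proof -
    have "measure_pmf.expectation \<phi> h
        = measure_pmf.expectation \<phi> (\<lambda>y. (real (min (word_length G S y) r))\<^sup>2) / (real r)\<^sup>2"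
      unfolding h_def by simp
    also have "\<dots> \<le> 4 * \<rho> 0 * integral {0..real r} (\<lambda>s. s / \<rho> s) / (real r)\<^sup>2"
      using truncated_second_moment_le[OF cont mono ge1 \<phi>(2) s] by (intro divide_right_mono) auto
    finally have "M * measure_pmf.expectation \<phi> h \<le> M * (4 * \<rho> 0 * integral {0..real r} (\<lambda>s. s / \<rho> s) / (real r)\<^sup>2)"
      using M by (intro mult_left_mono) auto
    then show ?thesis by (simp add: x_def mult_ac)
  qed
  have Eh0: "0 \<le> measure_pmf.expectation \<phi> h" using h by (intro integral_nonneg_AE) auto
  have x0: "0 \<le> x" using Eh Eh0 M by (smt (verit) mult_nonneg_nonneg)
  have "R k * (1 - x) \<le> R k * (1 - M * measure_pmf.expectation \<phi> h)"
    using Eh pos by (intro mult_left_mono) auto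
  also have "\<dots> = measure_pmf.expectation \<phi> (\<lambda>y. R k * (1 - M * h y))"
    using ih by (simp add: Bochner_Integration.integral_diff)
  also have "\<dots> \<le> measure_pmf.expectation \<phi> (corr g)"
  proof (intro integral_mono_AE)
    show "integrable \<phi> (\<lambda>y. R k * (1 - M * h y))" using ih by auto
    show "integrable \<phi> (corr g)" by (rule integrable_corr)
    show "AE y in \<phi>. R k * (1 - M * h y) \<le> corr g y"
      using s defect by (auto simp: AE_measure_pmf_iff)
  qed
  finally have E: "1 - x \<le> measure_pmf.expectation \<phi> (corr g) / corr g \<one>"
    using pos by (simp add: a field_simps)
  have "exp (- (A * real r + 4 * real n * x)) = exp (- A * real r) * exp (- (2 * real (2 * n) * x))"
    by (simp add: exp_add[symmetric] algebra_simps)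
  also have "\<dots> \<le> corr g \<one> * (1 - x) ^ (2 * n)"
    using k(1) a pos exp_le_one_minus_power[OF x0 x, of "2 * n"] by (intro mult_mono) auto
  also have "\<dots> \<le> corr g \<one> * (measure_pmf.expectation \<phi> (corr g) / corr g \<one>) ^ (2 * n)"
    using E x pos a by (intro mult_left_mono power_mono) auto
  also have "\<dots> \<le> pmf (conv_power G \<phi> (2 * n)) \<one>"
    using return_prob_ge_test_function[OF g(3) \<phi>(1)] a pos by simp
  finally show ?thesis .
qed

lemma word_length_one: "word_length G S \<one> = 0"
  using word_length_le[of "[]" S \<one>] by simp

text \<open>Levels \<open>s < \<rho> 0\<close> are harmless for every probability measure.\<close>

lemma weak_moment_le:
  assumes "set_pmf \<phi> \<subseteq> carrier G"
    and "\<And>s. s \<ge> \<rho> 0 \<Longrightarrow> s * measure_pmf.prob \<phi> {g \<in> carrier G. \<rho> (real (word_length G S g)) > s} \<le> 2 * \<rho> 0"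
  shows "weak_moment G S \<rho> \<phi> \<le> ennreal (2 * \<rho> 0)"
  unfolding weak_moment_def
proof (intro SUP_least ennreal_leI)
  fix s :: real assume "s \<in> {0<..}"
  then have s: "s > 0" by simp
  show "s * measure_pmf.prob \<phi> {g \<in> carrier G. \<rho> (real (word_length G S g)) > s} \<le> 2 * \<rho> 0"
  proof (cases "s \<ge> \<rho> 0")
    case False
    have "s * measure_pmf.prob \<phi> {g \<in> carrier G. \<rho> (real (word_length G S g)) > s} \<le> s * 1"
      using s by (intro mult_left_mono) auto
    then show ?thesis using False ge1[of 0] by simp
  qed (use assms(2) in auto)
qed

lemma admissible_point_mass:
  "symmetric_prob G (return_pmf \<one>) \<and> weak_moment G S \<rho> (return_pmf \<one>) \<le> ennreal (2 * \<rho> 0)"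
proof
  show "symmetric_prob G (return_pmf \<one>)"
    by (auto simp: symmetric_prob_iff_reflect reflect_def)
  show "weak_moment G S \<rho> (return_pmf \<one>) \<le> ennreal (2 * \<rho> 0)"
    using ge1[of 0] by (intro weak_moment_le) (auto simp: word_length_one)
qed

lemma weak_return_inf_ge:
  assumes "\<And>\<phi>. symmetric_prob G \<phi> \<Longrightarrow> weak_moment G S \<rho> \<phi> \<le> ennreal (2 * \<rho> 0) \<Longrightarrow>
    c \<le> pmf (conv_power G \<phi> (2 * n)) \<one>"
  shows "c \<le> weak_return_inf G S \<rho> n"
  unfolding weak_return_inf_def
  by (rule cInf_greatest) (use admissible_point_mass assms in auto)

lemma weak_return_inf_le:
  assumes "symmetric_prob G \<phi>" "weak_moment G S \<rho> \<phi> \<le> ennreal (2 * \<rho> 0)"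
  shows "weak_return_inf G S \<rho> n \<le> pmf (conv_power G \<phi> (2 * n)) \<one>"
  unfolding weak_return_inf_def
  by (rule cInf_lower) (use assms in \<open>auto intro!: bdd_belowI[where m=0]\<close>)

text \<open>The exponent \<open>1 / 3\<close> of the return probability enters here: \<open>2 r\<^sup>3\<close> steps of the walk cost a factor
  exponential in \<open>r\<close>, while their average cost per step is of order \<open>r^(-2)\<close>, the scale on which truncated
  second moments live.\<close>

lemma weak_return_inf_lower_bound:
  assumes "real_ext (return_prob G S) \<greatersim>\<^sub>d (\<lambda>t. exp (- (t powr (1 / 3))))"
  shows "\<exists>C\<ge>1. \<exists>r\<^sub>0\<ge>1. \<forall>r\<ge>r\<^sub>0. \<forall>n.
    C * (integral {0..real r} (\<lambda>s. s / \<rho> s) / (real r)\<^sup>2) \<le> 1 / 2 \<longrightarrow>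
    exp (- (C * (real r + real n * (integral {0..real r} (\<lambda>s. s / \<rho> s) / (real r)\<^sup>2))))
      \<le> weak_return_inf G S \<rho> n"
proof -
  obtain c1 c2 where c: "c1 > 0" "c2 > 0"
    "eventually (\<lambda>t. real_ext (return_prob G S) t \<ge> c1 * exp (- ((c2 * t) powr (1 / 3)))) at_top"
    using assms by (auto simp: dil_ge_def)
  then obtain T where T: "\<And>t. t \<ge> T \<Longrightarrow> real_ext (return_prob G S) t \<ge> c1 * exp (- ((c2 * t) powr (1 / 3)))"
    by (auto simp: eventually_at_top_linorder)
  \<comment> \<open>The first summand absorbs the multiplicative constant, as \<open>r \<ge> 1\<close>.\<close>
  define A where "A = \<bar>ln c1\<bar> + (2 * c2) powr (1 / 3)"
  define M where "M = max 1 ((real (card S))\<^sup>2 * A)"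
  define C where "C = max A (16 * M * \<rho> 0)"
  have A: "A \<ge> 0" by (simp add: A_def)
  have M: "M \<ge> 1" by (simp add: M_def)
  have M0: "M * \<rho> 0 \<ge> 1" using M ge1[of 0] mult_mono[of 1 M 1 "\<rho> 0"] by simp
  have ret: "exp (- A * real r) \<le> return_prob G S (2 * r ^ 3)" if "real r \<ge> T" "r \<ge> 1" for r
  proof -
    have "real r \<le> real (r ^ 3)" using that by (simp only: of_nat_le_iff) (simp add: self_le_power)
    then have "T \<le> real (2 * r ^ 3)" using that by (simp del: of_nat_power)
    moreover have "real_ext (return_prob G S) (real (2 * r ^ 3)) = return_prob G S (2 * r ^ 3)"
      by (simp only: real_ext_def floor_of_nat nat_int)
    ultimately have "c1 * exp (- ((c2 * real (2 * r ^ 3)) powr (1 / 3))) \<le> return_prob G S (2 * r ^ 3)"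
      using T[of "real (2 * r ^ 3)"] by metis
    moreover have e: "real (2 * r ^ 3) = 2 * real r ^ 3" by simp
    ultimately have ret: "c1 * exp (- ((c2 * (2 * real r ^ 3)) powr (1 / 3))) \<le> return_prob G S (2 * r ^ 3)"
      by (metis e)
    have cube: "(c2 * (2 * real r ^ 3)) powr (1 / 3) = (2 * c2) powr (1 / 3) * real r"
    proof -
      have "(real r ^ 3) powr (1 / 3) = real r"
      proof -
        have "real r ^ 3 = real r powr 3" using that by (simp add: powr_numeral)
        then show ?thesis by (simp only: powr_powr) simp
      qed
      then show ?thesis using c by (simp add: powr_mult mult_ac)
    qed
    have c1: "exp (- (\<bar>ln c1\<bar> * real r)) \<le> c1"
    proof -
      have "\<bar>ln c1\<bar> * 1 \<le> \<bar>ln c1\<bar> * real r" using that by (intro mult_left_mono) auto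
      then have "- (\<bar>ln c1\<bar> * real r) \<le> ln c1" by linarith
      then show ?thesis using c by (simp add: ln_ge_iff)
    qed
    have "exp (- A * real r) = exp (- (\<bar>ln c1\<bar> * real r)) * exp (- ((2 * c2) powr (1 / 3) * real r))"
      by (simp add: A_def exp_add[symmetric] algebra_simps)
    also have "\<dots> \<le> c1 * exp (- ((2 * c2) powr (1 / 3) * real r))"
      using c1 by (intro mult_right_mono) auto
    also have "\<dots> \<le> return_prob G S (2 * r ^ 3)" using ret by (simp only: cube)
    finally show ?thesis .
  qed
  show ?thesis
  proof (intro exI[of _ C] conjI exI[of _ "max 1 (nat \<lceil>T\<rceil>)"] allI impI)
    show "1 \<le> C" using M0 by (simp add: C_def mult.assoc)
    show "1 \<le> max 1 (nat \<lceil>T\<rceil>)" by simp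
    fix r n
    define J where "J = integral {0..real r} (\<lambda>s. s / \<rho> s) / (real r)\<^sup>2"
    assume r: "max 1 (nat \<lceil>T\<rceil>) \<le> r"
      and J: "C * (integral {0..real r} (\<lambda>s. s / \<rho> s) / (real r)\<^sup>2) \<le> 1 / 2"
    have "r \<ge> 1" "real r \<ge> T" using r by linarith+
    have "J \<ge> 0" unfolding J_def
      by (intro divide_nonneg_nonneg integral_nonneg integrable_ratio[OF cont mono ge1])
         (use ge1 in \<open>auto intro!: divide_nonneg_nonneg dest: order_trans[OF zero_le_one]\<close>)
    have "4 * M * \<rho> 0 * J \<le> C * J"
      using \<open>J \<ge> 0\<close> M0 by (intro mult_right_mono) (auto simp: C_def mult.assoc)
    also have "\<dots> \<le> 1 / 2" using J by (simp only: J_def)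
    finally have x: "4 * M * \<rho> 0 * J \<le> 1 / 2" .
    show "exp (- (C * (real r + real n * (integral {0..real r} (\<lambda>s. s / \<rho> s) / (real r)\<^sup>2))))
      \<le> weak_return_inf G S \<rho> n"
    proof (rule weak_return_inf_ge)
      fix \<phi> assume \<phi>: "symmetric_prob G \<phi>" "weak_moment G S \<rho> \<phi> \<le> ennreal (2 * \<rho> 0)"
      have "A * real r \<le> C * real r" by (intro mult_right_mono) (auto simp: C_def)
      moreover have "(16 * M * \<rho> 0) * (real n * J) \<le> C * (real n * J)"
        using \<open>J \<ge> 0\<close> by (intro mult_right_mono) (auto simp: C_def)
      ultimately have "A * real r + 4 * real n * (4 * M * \<rho> 0 * J) \<le> C * (real r + real n * J)"
        by (simp add: algebra_simps)
      then have "exp (- (C * (real r + real n * J))) \<le> exp (- (A * real r + 4 * real n * (4 * M * \<rho> 0 * J)))"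
        by simp
      also have "\<dots> \<le> pmf (conv_power G \<phi> (2 * n)) \<one>"
        using return_prob_lower_bound[OF \<phi> _ ret, of r n] x \<open>r \<ge> 1\<close> \<open>real r \<ge> T\<close>
        by (simp add: M_def J_def)
      finally show "exp (- (C * (real r + real n * (integral {0..real r} (\<lambda>s. s / \<rho> s) / (real r)\<^sup>2))))
         \<le> pmf (conv_power G \<phi> (2 * n)) \<one>" by (simp add: J_def)
    qed
  qed
qed

lemma word_length_inv:
  assumes "y \<in> carrier G"
  shows "word_length G S (inv y) \<le> word_length G S y"
proof -
  obtain ws where ws: "length ws = word_length G S y" "set ws \<subseteq> S" "foldr (\<otimes>) ws \<one> = y"
    using geodesic_word[OF S assms] .
  have "foldr (\<otimes>) (map (\<lambda>x. inv x) (rev ws)) \<one> = inv y"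
    using foldr_mult_inv[of ws] ws generators(3)[OF S] by auto
  then have "word_length G S (inv y) \<le> length (map (\<lambda>x. inv x) (rev ws))"
    using ws generators(5)[OF S] by (intro word_length_le) auto
  then show ?thesis using ws by simp
qed

text \<open>The lazy jump to the ball of radius \<open>r\<close>. It is admissible because it moves only with probability
  \<open>\<rho> 0 / \<rho> r\<close>, and no level above \<open>\<rho> r\<close> is reached.\<close>

lemma weak_return_inf_upper_bound:
  assumes c: "c > 0" "\<And>n. exp (c * real n) \<le> real (volume G S n)"
  shows "weak_return_inf G S \<rho> n \<le> exp (- (2 * real n * \<rho> 0 / \<rho> (real r))) + exp (- (c * real r))"
proof -
  define B where "B = {g \<in> carrier G. word_length G S g \<le> r}"
  have vol: "real (card B) \<ge> exp (c * real r)" using c(2)[of r] by (simp add: volume_def B_def)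
  then have B0: "card B > 0" using exp_gt_zero[of "c * real r"] by linarith
  then have B: "finite B" "B \<noteq> {}" "B \<subseteq> carrier G" by (auto simp: card_gt_0_iff B_def)
  define \<beta> where "\<beta> = pmf_of_set B"
  have "inv y \<in> B" if "y \<in> B" for y
    using that word_length_inv[of y] by (auto simp: B_def)
  then have "symmetric_prob G \<beta>" unfolding \<beta>_def
    by (intro symmetric_prob_uniform B)
  then have \<beta>: "set_pmf \<beta> \<subseteq> carrier G" "reflect \<beta> = \<beta>" by (auto simp: symmetric_prob_iff_reflect)
  have set\<beta>: "set_pmf \<beta> = B" using B by (simp add: \<beta>_def)
  define p where "p = \<rho> 0 / \<rho> (real r)"
  have \<rho>r: "\<rho> 0 \<le> \<rho> (real r)" "\<rho> 0 \<ge> 1" using mono_onD[OF mono, of 0 "real r"] ge1 by auto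
  have p: "0 \<le> p" "p \<le> 1" using \<rho>r by (auto simp: p_def)
  define \<phi> where "\<phi> = bind_pmf (bernoulli_pmf p) (\<lambda>b. if b then \<beta> else return_pmf \<one>)"
  have s\<phi>: "set_pmf \<phi> \<subseteq> carrier G" using \<beta> by (auto simp: \<phi>_def split: if_splits)
  have mix: "pmf \<phi> y = p * pmf \<beta> y + (1 - p) * pmf (return_pmf \<one>) y" for y
    using p by (simp add: \<phi>_def pmf_bind)
  have "reflect \<phi> = bind_pmf (bernoulli_pmf p) (\<lambda>b. if b then \<beta> else return_pmf \<one>)"
    using \<beta> unfolding reflect_def \<phi>_def map_bind_pmf by (intro bind_pmf_cong) auto
  then have sym: "symmetric_prob G \<phi>" using s\<phi> by (simp add: symmetric_prob_iff_reflect \<phi>_def)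
  have wm: "weak_moment G S \<rho> \<phi> \<le> ennreal (2 * \<rho> 0)"
  proof (rule weak_moment_le[OF s\<phi>])
    fix s assume s: "\<rho> 0 \<le> s"
    let ?X = "{g \<in> carrier G. \<rho> (real (word_length G S g)) > s}"
    show "s * measure_pmf.prob \<phi> ?X \<le> 2 * \<rho> 0"
    proof (cases "s < \<rho> (real r)")
      case True
      have "measure_pmf.prob \<phi> ?X \<le> measure_pmf.prob \<phi> (- {\<one>})"
        using s by (intro measure_pmf.finite_measure_mono) (auto simp: word_length_one)
      also have "\<dots> = 1 - pmf \<phi> \<one>" by (simp add: measure_pmf.prob_compl[symmetric] measure_pmf_single[symmetric] Compl_eq_Diff_UNIV)
      also have "\<dots> \<le> p" using p by (simp add: mix)
      finally have "s * measure_pmf.prob \<phi> ?X \<le> \<rho> (real r) * p"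
        using True s \<rho>r p by (intro mult_mono) auto
      then show ?thesis using \<rho>r by (simp add: p_def)
    next
      case False
      have "measure_pmf.prob \<phi> ?X = 0"
        unfolding measure_pmf_zero_iff
      proof -
        have "set_pmf \<phi> \<subseteq> insert \<one> B" using set\<beta> by (auto simp: \<phi>_def split: if_splits)
        moreover have "\<rho> (real (word_length G S y)) \<le> s" if "y \<in> insert \<one> B" for y
        proof -
          have "word_length G S y \<le> r" using that by (auto simp: B_def word_length_one)
          then have "\<rho> (real (word_length G S y)) \<le> \<rho> (real r)" by (intro mono_onD[OF mono]) auto
          then show ?thesis using False by linarith
        qed
        ultimately show "set_pmf \<phi> \<inter> ?X = {}" by fastforce
      qed
      then show ?thesis using \<rho>r by simp
    qed
  qed
  define V where "V = 1 / real (card B)"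
  have V: "0 \<le> V" "V \<le> exp (- (c * real r))"
    using vol B0 by (auto simp: V_def exp_minus field_simps)
  \<comment> \<open>Condition on whether a jump has occurred: the first term is the probability that none has.\<close>
  have bound: "pmf (conv_power G \<phi> m) z \<le> (1 - p) ^ m + (1 - (1 - p) ^ m) * V" if "z \<in> carrier G" for m z
    using that
  proof (induction m arbitrary: z)
    case (Suc m)
    let ?\<psi> = "conv_power G \<phi> m"
    have s\<psi>: "set_pmf ?\<psi> \<subseteq> carrier G" using s\<phi> by (rule set_conv_power)
    have "\<phi> \<odot> ?\<psi> = bind_pmf (bernoulli_pmf p) (\<lambda>b. (if b then \<beta> else return_pmf \<one>) \<odot> ?\<psi>)"
      unfolding convolve_bind \<phi>_def bind_assoc_pmf ..
    then have "pmf (\<phi> \<odot> ?\<psi>) z = p * pmf (\<beta> \<odot> ?\<psi>) z + (1 - p) * pmf ?\<psi> z"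
      using p s\<psi> by (simp add: pmf_bind convolve_one_left)
    also have "\<dots> \<le> p * V + (1 - p) * ((1 - p) ^ m + (1 - (1 - p) ^ m) * V)"
    proof (intro add_mono mult_left_mono)
      show "pmf (\<beta> \<odot> ?\<psi>) z \<le> V" using Suc.prems B
        by (intro pmf_convolve_le_left \<beta> s\<psi>) (auto simp: \<beta>_def V_def indicator_def)
    qed (use p Suc in auto)
    finally show ?case by (simp add: algebra_simps)
  qed (simp add: pmf_le_1)
  have "weak_return_inf G S \<rho> n \<le> pmf (conv_power G \<phi> (2 * n)) \<one>"
    by (rule weak_return_inf_le[OF sym wm])
  also have "\<dots> \<le> (1 - p) ^ (2 * n) + (1 - (1 - p) ^ (2 * n)) * V" by (rule bound) simp
  also have "\<dots> \<le> exp (- (2 * real n * \<rho> 0 / \<rho> (real r))) + exp (- (c * real r))"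
  proof (rule add_mono)
    have "(1 - p) ^ (2 * n) \<le> exp (- p) ^ (2 * n)"
      using p exp_ge_add_one_self[of "- p"] by (intro power_mono) auto
    then show "(1 - p) ^ (2 * n) \<le> exp (- (2 * real n * \<rho> 0 / \<rho> (real r)))"
      by (simp add: exp_of_nat_mult[symmetric] p_def)
    have "(1 - (1 - p) ^ (2 * n)) * V \<le> 1 * V" using V p by (intro mult_right_mono) auto
    then show "(1 - (1 - p) ^ (2 * n)) * V \<le> exp (- (c * real r))" using V by linarith
  qed
  finally show ?thesis .
qed

end
end
end

section \<open>Regular variation and the integral of \<open>s / \<rho> s\<close>\<close>

lemma tail_integral_tendsto_0:
  fixes h :: "real \<Rightarrow> real"
  assumes h: "h integrable_on {0..}" and nonneg: "\<And>s. s \<ge> 0 \<Longrightarrow> 0 \<le> h s"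
  shows "((\<lambda>t. integral {t..} h) \<longlongrightarrow> 0) at_top"
proof -
  have ab: "set_integrable lebesgue {0..} h"
    using h nonneg by (intro nonnegative_absolutely_integrable_1) auto
  have sub: "set_integrable lebesgue A h" if "A \<subseteq> {0..}" "A \<in> sets lebesgue" for A
    using set_integrable_subset[OF ab] that by auto
  have "((\<lambda>t. LINT x:{0..t}|lebesgue. h x) \<longlongrightarrow> (LINT x:{0..}|lebesgue. h x)) at_top"
    by (intro tendsto_set_lebesgue_integral_at_top ab) auto
  moreover have "(LINT x:{0..t}|lebesgue. h x) = integral {0..t} h" for t
    by (intro set_lebesgue_integral_eq_integral sub) auto
  ultimately have lim: "((\<lambda>t. integral {0..t} h) \<longlongrightarrow> integral {0..} h) at_top"
    using set_lebesgue_integral_eq_integral(2)[OF ab] by simp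
  have split: "integral {0..} h - integral {0..t} h = integral {t..} h" if "t \<ge> 0" for t
  proof -
    have "h integrable_on {0..t}" "h integrable_on {t..}"
      using that by (auto intro!: set_lebesgue_integral_eq_integral sub)
    moreover have "{0..t} \<inter> {t..} = {t}" "{0..t} \<union> {t..} = {0..}" using that by auto
    ultimately show ?thesis using integral_Un[of h "{0..t}" "{t..}"] by simp
  qed
  have "((\<lambda>t. integral {0..} h - integral {0..t} h) \<longlongrightarrow> integral {0..} h - integral {0..} h) at_top"
    by (intro tendsto_intros lim)
  then show ?thesis
    using split by (auto elim!: Lim_transform_eventually intro: eventually_mono[OF eventually_ge_at_top[of 0]])
qed

text \<open>The tail integral tends to 0, but as \<open>inverse 0 = 0\<close> it also has to be positive, for which \<open>l\<close> is bounded
  on a unit interval by monotonicity.\<close>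

lemma inverse_tail_at_top:
  fixes l \<rho> :: "real \<Rightarrow> real"
  assumes l: "mono_on {0..} l" "\<And>t. t \<ge> 0 \<Longrightarrow> l t \<ge> 1"
    and int: "(\<lambda>s. 1 / ((1 + s) * l s)) integrable_on {0..}"
    and dom: "\<rho> \<greatersim>\<^sub>d (\<lambda>t. inverse (integral {t..} (\<lambda>s. 1 / ((1 + s) * l s))))"
  shows "filterlim \<rho> at_top at_top"
proof -
  define h where "h s = 1 / ((1 + s) * l s)" for s
  have h0: "0 \<le> h s" if "s \<ge> 0" for s
    using l(2)[OF that] that by (simp add: h_def)
  have hi: "h integrable_on {0..}" using int by (simp add: h_def[abs_def])
  have ab: "set_integrable lebesgue {0..} h"
    using hi h0 by (intro nonnegative_absolutely_integrable_1) auto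
  have sub: "h integrable_on A" if "A \<subseteq> {0..}" "A \<in> sets lebesgue" for A
    using set_integrable_subset[OF ab] that by (intro set_lebesgue_integral_eq_integral) auto
  have pos: "integral {t..} h > 0" if t: "t \<ge> 0" for t
  proof -
    have lt: "l (t + 1) \<ge> 1" using l(2) t by simp
    then have "0 < 1 / ((2 + t) * l (t + 1))" using t by simp
    also have "\<dots> = integral {t..t+1} (\<lambda>_. 1 / ((2 + t) * l (t + 1)))" by simp
    also have "\<dots> \<le> integral {t..t+1} h"
    proof (rule integral_le)
      fix s assume s: "s \<in> {t..t + 1}"
      have "l s \<le> l (t + 1)" "l s \<ge> 1" using s t by (auto intro!: mono_onD[OF l(1)] l(2))
      then have "(1 + s) * l s \<le> (2 + t) * l (t + 1)" using s t lt by (intro mult_mono) auto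
      moreover have "0 < (1 + s) * l s" using \<open>l s \<ge> 1\<close> s t by (intro mult_pos_pos) auto
      ultimately show "1 / ((2 + t) * l (t + 1)) \<le> h s"
        unfolding h_def by (intro divide_left_mono) auto
    qed (use t in \<open>auto intro!: sub\<close>)
    also have "\<dots> \<le> integral {t..} h"
      using t h0 by (intro integral_subset_le sub) auto
    finally show ?thesis .
  qed
  obtain c1 c2 where c: "c1 > 0" "c2 > 0"
    and ev: "eventually (\<lambda>t. \<rho> t \<ge> c1 * inverse (integral {c2 * t..} h)) at_top"
    using dom unfolding dil_ge_def h_def[abs_def] by auto
  have "filterlim (\<lambda>t. integral {t..} h) (at_right 0) at_top"
    unfolding filterlim_at
  proof
    show "eventually (\<lambda>t. integral {t..} h \<in> {0<..} \<and> integral {t..} h \<noteq> 0) at_top"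
      using eventually_ge_at_top[of 0] by eventually_elim (use pos in force)
  qed (use tail_integral_tendsto_0[OF hi h0] in auto)
  then have "filterlim (\<lambda>t. inverse (integral {t..} h)) at_top at_top"
    by (rule filterlim_compose[OF filterlim_inverse_at_top_right])
  moreover have "filterlim (\<lambda>t. c2 * t) at_top at_top"
    using c by (intro filterlim_tendsto_pos_mult_at_top[OF tendsto_const]) (auto simp: filterlim_ident)
  ultimately have "filterlim (\<lambda>t. inverse (integral {c2 * t..} h)) at_top at_top"
    by (rule filterlim_compose)
  then have "filterlim (\<lambda>t. c1 * inverse (integral {c2 * t..} h)) at_top at_top"
    using c by (intro filterlim_tendsto_pos_mult_at_top[OF tendsto_const]) auto
  then show ?thesis using ev by (rule filterlim_at_top_mono)
qed

lemma eventually_dilate_le: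
  assumes "slowly_varying f" "eventually (\<lambda>x. f x > 0) at_top" "c > 0" "q > (1::real)"
  shows "eventually (\<lambda>x. f (c * x) \<le> q * f x) at_top"
proof -
  have "((\<lambda>x. f (c * x) / f x) \<longlongrightarrow> c powr 0) at_top"
    using assms unfolding regularly_varying_def by auto
  then have "eventually (\<lambda>x. f (c * x) / f x < q) at_top"
    using assms by (intro order_tendstoD) auto
  then show ?thesis using assms(2) by eventually_elim (simp add: field_simps)
qed

lemma eventually_dilate_ge:
  assumes "slowly_varying f" "eventually (\<lambda>x. f x > 0) at_top" "c > 0" "q < (1::real)"
  shows "eventually (\<lambda>x. f (c * x) \<ge> q * f x) at_top"
proof -
  have "((\<lambda>x. f (c * x) / f x) \<longlongrightarrow> c powr 0) at_top"
    using assms unfolding regularly_varying_def by auto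
  then have "eventually (\<lambda>x. f (c * x) / f x > q) at_top"
    using assms by (intro order_tendstoD) auto
  then show ?thesis using assms(2) by eventually_elim (simp add: field_simps)
qed

context
  fixes \<rho> :: "real \<Rightarrow> real"
  assumes cont: "continuous_on {0..} \<rho>" and mono: "mono_on {0..} \<rho>" and ge1: "\<And>t. t \<ge> 0 \<Longrightarrow> \<rho> t \<ge> 1"
begin

abbreviation (input) "ratio_integral r \<equiv> integral {0..r} (\<lambda>s. s / \<rho> s)"

lemmas integrable_ratio' = integrable_ratio[OF cont mono ge1]

lemma ratio_nonneg: "0 \<le> s \<Longrightarrow> 0 \<le> s / \<rho> s"
  using ge1[of s] by simp

lemma ratio_integral_mono: "0 \<le> a \<Longrightarrow> a \<le> b \<Longrightarrow> ratio_integral a \<le> ratio_integral b"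
  by (intro integral_subset_le integrable_ratio') (auto intro: ratio_nonneg)

lemma ratio_integral_one: "ratio_integral 1 > 0"
proof -
  have "1 / \<rho> 1 \<le> 2 * ratio_integral 1" using sum_le_integral_ratio[OF cont mono ge1, of 1] by simp
  moreover have "1 / \<rho> 1 > 0" using ge1[of 1] by simp
  ultimately show ?thesis by linarith
qed

text \<open>Compare \<open>s / \<rho> s\<close> with the affine function \<open>T + \<epsilon> s\<close>, where \<open>\<rho>\<close> is at least \<open>1 / \<epsilon>\<close> beyond \<open>T\<close>.\<close>

lemma ratio_average_small:
  assumes "filterlim \<rho> at_top at_top" "\<epsilon> > 0"
  shows "eventually (\<lambda>r. ratio_integral r / r\<^sup>2 \<le> \<epsilon>) at_top"
proof -
  have "eventually (\<lambda>s. \<rho> s \<ge> 1 / \<epsilon>) at_top" using assms(1) by (simp add: filterlim_at_top)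
  then obtain T0 where "\<And>s. s \<ge> T0 \<Longrightarrow> \<rho> s \<ge> 1 / \<epsilon>" by (auto simp: eventually_at_top_linorder)
  then obtain T where T: "T \<ge> 1" "\<And>s. s \<ge> T \<Longrightarrow> \<rho> s \<ge> 1 / \<epsilon>"
    by (metis max.cobounded1 max.cobounded2 order_trans)
  have "ratio_integral r / r\<^sup>2 \<le> \<epsilon>" if r: "r \<ge> max 1 (2 * T / \<epsilon>)" for r
  proof -
    have r1: "r \<ge> 1" and r2: "2 * T / \<epsilon> \<le> r" using r by auto
    have hi: "((\<lambda>s. T + \<epsilon> * s) has_integral (T * (r - 0) + \<epsilon> * ((r\<^sup>2 - 0\<^sup>2) / 2))) {0..r}"
      using has_integral_const_real[of T 0 r] r1
      by (intro has_integral_add has_integral_mult_right ident_has_integral) (auto simp: mult.commute)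
    have "ratio_integral r \<le> T * (r - 0) + \<epsilon> * ((r\<^sup>2 - 0\<^sup>2) / 2)"
    proof (rule has_integral_le[OF integrable_integral[OF integrable_ratio'] hi])
      fix s assume "s \<in> {0..r}"
      then have s: "s \<ge> 0" by simp
      have p: "\<rho> s > 0" using ge1[OF s] by linarith
      show "s / \<rho> s \<le> T + \<epsilon> * s"
      proof (cases "s \<ge> T")
        case True
        have "1 \<le> \<epsilon> * \<rho> s" using T(2)[OF True] assms(2) by (simp add: field_simps)
        then have "s * 1 \<le> s * (\<epsilon> * \<rho> s)" using s by (intro mult_left_mono)
        then have "s / \<rho> s \<le> \<epsilon> * s" using p by (simp add: field_simps)
        then show ?thesis using T(1) by linarith
      next
        case False
        have "s / \<rho> s \<le> s / 1" using s ge1[OF s] by (intro divide_left_mono) auto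
        then show ?thesis using False assms(2) s by (smt (verit) div_by_1 mult_nonneg_nonneg)
      qed
    qed simp_all
    moreover have "T * r \<le> \<epsilon> * r\<^sup>2 / 2"
    proof -
      have "2 * T \<le> \<epsilon> * r" using r2 assms(2) by (simp add: field_simps)
      then have "2 * T * r \<le> \<epsilon> * r * r" using r1 by (intro mult_right_mono) auto
      then show ?thesis by (simp add: power2_eq_square)
    qed
    ultimately have "ratio_integral r \<le> \<epsilon> * r\<^sup>2" by simp
    then show ?thesis using r1 by (simp add: field_simps)
  qed
  then show ?thesis unfolding eventually_at_top_linorder by blast
qed

text \<open>The easy half of Karamata's theorem: if \<open>\<rho>\<close> grows no faster than a power \<open>\<gamma> < 2\<close>, then \<open>s / \<rho> s\<close> is at
  most a multiple of \<open>(r\<^sup>\<gamma> / \<rho> r) s^(1-\<gamma>)\<close>, whose integral up to \<open>r\<close> is of order \<open>r\<^sup>2 / \<rho> r\<close>. The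
  growth condition at \<open>T\<close> also bounds \<open>r\<^sup>2 / \<rho> r\<close> from below, which absorbs the integral up to \<open>T\<close>.\<close>

lemma ratio_average_Karamata:
  assumes \<gamma>: "0 \<le> \<gamma>" "\<gamma> < 2" and T: "T \<ge> 1" and K: "K > 0"
    and growth: "\<And>s r. T \<le> s \<Longrightarrow> s \<le> r \<Longrightarrow> \<rho> r \<le> K * (r / s) powr \<gamma> * \<rho> s"
  shows "\<exists>C>0. \<forall>r\<ge>T. ratio_integral r / r\<^sup>2 \<le> C / \<rho> r"
proof (intro exI[of _ "ratio_integral T * (K * \<rho> T) + K / (2 - \<gamma>)"] conjI allI impI)
  have IT: "ratio_integral T \<ge> 0" by (intro integral_nonneg integrable_ratio' ratio_nonneg) auto
  have \<rho>T: "\<rho> T > 0" using ge1[of T] T by simp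
  show "ratio_integral T * (K * \<rho> T) + K / (2 - \<gamma>) > 0" using IT \<rho>T K \<gamma> by (intro add_nonneg_pos) auto
  fix r assume r: "T \<le> r"
  have r1: "r \<ge> 1" using r T by simp
  have \<rho>r: "\<rho> r > 0" using ge1[of r] r1 by simp
  have "1 \<le> K * \<rho> T * (r\<^sup>2 / \<rho> r)"
  proof -
    have "\<rho> r \<le> K * (r / T) powr \<gamma> * \<rho> T" using growth[of T r] r by simp
    also have "(r / T) powr \<gamma> \<le> r powr 2"
    proof -
      have "(r / T) powr \<gamma> \<le> r powr \<gamma>" using T r1 \<gamma> by (intro powr_mono2) (auto simp: field_simps mult_le_cancel_left1)
      also have "\<dots> \<le> r powr 2" using \<gamma> r1 by (intro powr_mono) auto
      finally show ?thesis .
    qed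
    then have "K * (r / T) powr \<gamma> * \<rho> T \<le> K * r powr 2 * \<rho> T"
      using K \<rho>T by (intro mult_right_mono mult_left_mono) auto
    finally show ?thesis using \<rho>r r1 by (simp add: field_simps powr_numeral)
  qed
  then have "ratio_integral T * 1 \<le> ratio_integral T * (K * \<rho> T * (r\<^sup>2 / \<rho> r))" using IT by (intro mult_left_mono)
  moreover have "integral {T..r} (\<lambda>s. s / \<rho> s) \<le> K / (2 - \<gamma>) * (r\<^sup>2 / \<rho> r)"
  proof -
    let ?f = "\<lambda>s. K * r powr \<gamma> / \<rho> r * s powr (1 - \<gamma>)"
    have hi: "(?f has_integral (K * r powr \<gamma> / \<rho> r * (r powr (1 - \<gamma> + 1) / (1 - \<gamma> + 1)))) {0..r}"
      using \<gamma> r1 by (intro has_integral_mult_right has_integral_powr_from_0) auto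
    have fi: "?f integrable_on {T..r}"
      by (rule integrable_on_subinterval[OF has_integral_integrable[OF hi]]) (use T in auto)
    have "integral {T..r} (\<lambda>s. s / \<rho> s) \<le> integral {T..r} ?f"
    proof (rule integral_le[OF integrable_ratio' fi])
      fix s assume s: "s \<in> {T..r}"
      have s0: "s > 0" and "\<rho> s > 0" using s T ge1[of s] by auto
      have "\<rho> r \<le> K * (r / s) powr \<gamma> * \<rho> s" using growth s by auto
      then have "1 / \<rho> s \<le> K * (r / s) powr \<gamma> / \<rho> r" using \<open>\<rho> s > 0\<close> \<rho>r by (simp add: field_simps)
      then have "s * (1 / \<rho> s) \<le> s * (K * (r / s) powr \<gamma> / \<rho> r)" using s0 by (intro mult_left_mono) auto
      also have "\<dots> = ?f s" using s0 r1 by (simp add: powr_divide powr_diff mult_ac)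
      finally show "s / \<rho> s \<le> ?f s" by simp
    qed (use T in auto)
    also have "\<dots> \<le> integral {0..r} ?f"
      using T hi fi \<rho>r K by (intro integral_subset_le) (auto simp: integrable_on_def)
    also have "\<dots> = K * r powr \<gamma> / \<rho> r * (r powr (1 - \<gamma> + 1) / (1 - \<gamma> + 1))"
      using hi by (rule integral_unique)
    also have "\<dots> = K / (2 - \<gamma>) * ((r powr \<gamma> * r powr (2 - \<gamma>)) / \<rho> r)"
      by (simp add: mult_ac)
    also have "r powr \<gamma> * r powr (2 - \<gamma>) = r\<^sup>2" using r1 by (simp add: powr_add[symmetric] powr_numeral)
    finally show ?thesis .
  qed
  moreover have "ratio_integral T + integral {T..r} (\<lambda>s. s / \<rho> s) = ratio_integral r"
    using T r by (intro Henstock_Kurzweil_Integration.integral_combine integrable_ratio') auto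
  ultimately have "ratio_integral r \<le> (ratio_integral T * (K * \<rho> T) + K / (2 - \<gamma>)) * (r\<^sup>2 / \<rho> r)"
    by (simp add: algebra_simps)
  then show "ratio_integral r / r\<^sup>2 \<le> (ratio_integral T * (K * \<rho> T) + K / (2 - \<gamma>)) / \<rho> r"
    using r1 \<rho>r by (simp add: field_simps)
qed

text \<open>Eventually doubling the argument costs at most a factor \<open>sqrt 2\<close>; iterate this up to the dyadic multiple
  of \<open>s\<close> next above \<open>r\<close> (a Potter bound with exponent \<open>1 / 2\<close>).\<close>

lemma slowly_varying_growth:
  assumes "slowly_varying \<rho>"
  shows "\<exists>T\<ge>1. \<forall>s r. T \<le> s \<longrightarrow> s \<le> r \<longrightarrow> \<rho> r \<le> sqrt 2 * (r / s) powr (1 / 2) * \<rho> s"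
proof -
  have "eventually (\<lambda>x. \<rho> x > 0) at_top"
    using eventually_ge_at_top[of 0] by eventually_elim (use ge1 in force)
  then have "eventually (\<lambda>x. \<rho> (2 * x) \<le> sqrt 2 * \<rho> x) at_top"
    using assms by (intro eventually_dilate_le) auto
  then obtain T0 where "\<And>x. x \<ge> T0 \<Longrightarrow> \<rho> (2 * x) \<le> sqrt 2 * \<rho> x"
    by (auto simp: eventually_at_top_linorder)
  then obtain T where T: "T \<ge> 1" "\<And>x. x \<ge> T \<Longrightarrow> \<rho> (2 * x) \<le> sqrt 2 * \<rho> x"
    by (metis max.cobounded1 max.cobounded2 order_trans)
  have double: "\<rho> (2 ^ m * s) \<le> sqrt 2 ^ m * \<rho> s" if "s \<ge> T" for m s
  proof (induction m)
    case (Suc m)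
    have "T * 1 \<le> s * 2 ^ m" using that T(1) by (intro mult_mono) auto
    then have "\<rho> (2 * (2 ^ m * s)) \<le> sqrt 2 * \<rho> (2 ^ m * s)" by (intro T(2)) (simp add: mult.commute)
    also have "\<dots> \<le> sqrt 2 * (sqrt 2 ^ m * \<rho> s)" using Suc by (intro mult_left_mono) auto
    finally show ?case by (simp add: mult_ac)
  qed simp
  show ?thesis
  proof (intro exI[of _ T] conjI T(1) allI impI)
    fix s r assume s: "T \<le> s" "s \<le> r"
    have s0: "s > 0" using s T by simp
    define m where "m = nat \<lfloor>log 2 (r / s)\<rfloor>"
    have q: "r / s \<ge> 1" using s s0 by simp
    then have lg: "log 2 (r / s) \<ge> 0" by (simp add: zero_le_log_cancel_iff)
    then have m: "real m \<le> log 2 (r / s)" "log 2 (r / s) \<le> real (Suc m)"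
      unfolding m_def by linarith+
    have "2 powr real m \<le> r / s" using m(1) q by (subst (asm) le_log_iff) auto
    have "r / s \<le> 2 powr real (Suc m)" using m(2) q by (subst (asm) log_le_iff) auto
    then have "r / s \<le> 2 ^ Suc m" by (subst (asm) powr_realpow) auto
    then have "r \<le> 2 ^ Suc m * s" using s0 by (simp add: pos_divide_le_eq)
    then have "\<rho> r \<le> \<rho> (2 ^ Suc m * s)" using s s0 by (intro mono_onD[OF mono]) auto
    also have "\<dots> \<le> sqrt 2 ^ Suc m * \<rho> s" by (rule double[OF s(1)])
    also have "\<dots> = sqrt 2 * sqrt 2 ^ m * \<rho> s" by simp
    also have "\<dots> \<le> sqrt 2 * (r / s) powr (1 / 2) * \<rho> s"
    proof (intro mult_right_mono mult_left_mono)
      have "sqrt 2 ^ m = (2 powr real m) powr (1 / 2)"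
        by (simp add: powr_realpow powr_half_sqrt real_sqrt_power)
      also have "\<dots> \<le> (r / s) powr (1 / 2)" using \<open>2 powr real m \<le> r / s\<close> by (intro powr_mono2) auto
      finally show "sqrt 2 ^ m \<le> (r / s) powr (1 / 2)" .
    qed (use ge1[of s] s0 in auto)
    finally show "\<rho> r \<le> sqrt 2 * (r / s) powr (1 / 2) * \<rho> s" .
  qed
qed

end

section \<open>Choice of the radius\<close>

lemma half_le_floor: "2 \<le> y \<Longrightarrow> y / 2 \<le> real (nat \<lfloor>y\<rfloor>)" for y :: real
  by linarith

lemma ceiling_le_double: "1 \<le> y \<Longrightarrow> real (nat \<lceil>y\<rceil>) \<le> 2 * y" for y :: real
  by linarith

context
  fixes G :: "('a, 'b) monoid_scheme" and S :: "'a set" and \<rho> :: "real \<Rightarrow> real"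
  assumes G: "group G" and S: "symmetric_generating_set G S"
    and cont: "continuous_on {0..} \<rho>" and mono: "mono_on {0..} \<rho>" and ge1: "\<And>t. t \<ge> 0 \<Longrightarrow> \<rho> t \<ge> 1"
    and top: "filterlim \<rho> at_top at_top"
begin

abbreviation (input) "inf_return \<equiv> weak_return_inf G S \<rho>"

context
  assumes ret: "real_ext (return_prob G S) \<greatersim>\<^sub>d (\<lambda>t. exp (- (t powr (1/3))))"
begin

text \<open>Take \<open>r\<close> near \<open>x = t^(1/3)\<close>. The exponent is then at most a multiple of \<open>x + x I (2 x)\<close>, where \<open>I\<close> is the
  integral of \<open>s / \<rho> s\<close> from 0. As \<open>I\<close> is bounded below by \<open>\<delta> = I 1 > 0\<close> on \<open>[1, \<infinity>)\<close>, dilating \<open>t\<close> by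
  \<open>c\<^sup>3\<close> absorbs both terms.\<close>

lemma lower_bound_ratio_integral:
  "real_ext inf_return \<greatersim>\<^sub>d (\<lambda>t. exp (- (t powr (1/3) * integral {0..t powr (1/3)} (\<lambda>s. s / \<rho> s))))"
proof -
  let ?I = "\<lambda>r. integral {0..r} (\<lambda>s. s / \<rho> s)"
  obtain C r0 where C: "C \<ge> 1" and low: "\<And>r n. r \<ge> r0 \<Longrightarrow> C * (?I (real r) / (real r)\<^sup>2) \<le> 1 / 2 \<Longrightarrow>
    exp (- (C * (real r + real n * (?I (real r) / (real r)\<^sup>2)))) \<le> inf_return n"
    using group.weak_return_inf_lower_bound[OF G S cont mono ge1 ret] by blast
  have "eventually (\<lambda>r. ?I r / r\<^sup>2 \<le> 1 / (2 * C)) at_top"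
    using C by (intro ratio_average_small[OF cont mono ge1 top]) auto
  then obtain R where R: "\<And>r. r \<ge> R \<Longrightarrow> ?I r / r\<^sup>2 \<le> 1 / (2 * C)"
    by (auto simp: eventually_at_top_linorder)
  define \<delta> where "\<delta> = ?I 1"
  have \<delta>: "\<delta> > 0" using ratio_integral_one[OF cont mono ge1] by (simp add: \<delta>_def)
  define c where "c = max 2 (C + 2 * C / \<delta>)"
  have c: "c \<ge> 2" "c \<ge> C + 2 * C / \<delta>" by (auto simp: c_def)
  have "real_ext inf_return t \<ge> 1 * exp (- ((c ^ 3 * t) powr (1/3) * ?I ((c ^ 3 * t) powr (1/3))))"
    if t: "t \<ge> 1" "t powr (1 / 3) \<ge> max R (real r0)" for t
  proof -
    define x where "x = t powr (1 / 3)"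
    define r where "r = nat \<lceil>x\<rceil>"
    define n where "n = nat \<lfloor>t\<rfloor>"
    have x1: "x \<ge> 1" using t by (simp add: x_def ge_one_powr_ge_zero)
    have x3: "x ^ 3 = t" using t by (simp add: x_def powr_realpow[symmetric] powr_powr del: powr_numeral)
    have r: "x \<le> real r" "real r \<le> 2 * x" "r \<ge> r0" "real r \<ge> R"
      using x1 t ceiling_le_double[OF x1] unfolding r_def x_def[symmetric] by linarith+
    have n: "real n \<le> t" using t unfolding n_def by linarith
    have I0: "0 \<le> ?I (real r)" "?I (real r) \<le> ?I (2 * x)" "\<delta> \<le> ?I (2 * x)" "?I (2 * x) \<le> ?I (c * x)"
      using r x1 c ratio_integral_mono[OF cont mono ge1, of 0 "real r"]
      unfolding \<delta>_def by (auto intro!: ratio_integral_mono[OF cont mono ge1] mult_right_mono)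
    have J: "?I (real r) / (real r)\<^sup>2 \<le> 1 / (2 * C)" using R r by blast
    then have J': "C * (?I (real r) / (real r)\<^sup>2) \<le> 1 / 2" using C by (simp add: field_simps)
    have "real n * (?I (real r) / (real r)\<^sup>2) \<le> t * (?I (2 * x) / x\<^sup>2)"
      using n I0 r x1 t by (intro mult_mono frac_le power_mono) auto
    also have "\<dots> = x * ?I (2 * x)"
      using x1 by (simp add: x3[symmetric] power2_eq_square power3_eq_cube)
    finally have "C * (real r + real n * (?I (real r) / (real r)\<^sup>2)) \<le> C * (2 * x + x * ?I (2 * x))"
      using C r by (intro mult_left_mono add_mono) auto
    also have "\<dots> \<le> (c * x) * ?I (c * x)"
    proof -
      have "2 * C * x = (2 * C / \<delta>) * x * \<delta>" using \<delta> by simp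
      also have "\<dots> \<le> (2 * C / \<delta>) * x * ?I (2 * x)"
        using I0 C \<delta> x1 by (intro mult_left_mono) auto
      finally have "C * (2 * x + x * ?I (2 * x)) \<le> (C + 2 * C / \<delta>) * (x * ?I (2 * x))"
        by (simp add: algebra_simps)
      also have "\<dots> \<le> c * (x * ?I (c * x))"
        using c I0 x1 \<delta> C by (intro mult_mono mult_left_mono) auto
      finally show ?thesis by (simp add: mult.assoc)
    qed
    finally have "exp (- ((c * x) * ?I (c * x))) \<le> exp (- (C * (real r + real n * (?I (real r) / (real r)\<^sup>2))))"
      by simp
    also have "\<dots> \<le> inf_return n" by (rule low[OF r(3) J'])
    finally have "exp (- ((c * x) * ?I (c * x))) \<le> inf_return n" .
    moreover have "(c ^ 3 * t) powr (1/3) = c * x"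
    proof -
      have "c ^ 3 * t = (c * x) ^ 3" by (simp add: power_mult_distrib x3)
      also have "\<dots> = (c * x) powr 3" using c x1 by (simp add: powr_numeral)
      also have "\<dots> powr (1 / 3) = c * x" using c x1 by (simp only: powr_powr) simp
      finally show ?thesis .
    qed
    ultimately show ?thesis by (simp add: real_ext_def n_def)
  qed
  note main = this
  have "eventually (\<lambda>t::real. t powr (1 / 3) \<ge> max R (real r0)) at_top"
    by real_asymp
  then have "eventually (\<lambda>t. real_ext inf_return t \<ge> 1 * exp (- ((c ^ 3 * t) powr (1/3) * ?I ((c ^ 3 * t) powr (1/3))))) at_top"
    using eventually_ge_at_top[of 1] by eventually_elim (rule main)
  then show ?thesis
    unfolding dil_ge_def using c by (intro exI[of _ 1] exI[of _ "c ^ 3"] conjI) auto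
qed

text \<open>Karamata's bound turns the average of \<open>s / \<rho> s\<close> into \<open>1 / \<rho> r\<close>, and the smallness condition of the
  general lower bound holds for all large \<open>r\<close> because \<open>\<rho>\<close> is unbounded.\<close>

lemma lower_bound_subquadratic:
  assumes "0 \<le> \<gamma>" "\<gamma> < 2" "T \<ge> 1" "K > 0"
    and "\<And>s r. T \<le> s \<Longrightarrow> s \<le> r \<Longrightarrow> \<rho> r \<le> K * (r / s) powr \<gamma> * \<rho> s"
  shows "\<exists>C\<ge>1. \<exists>R\<ge>1. \<forall>r n. R \<le> real r \<longrightarrow> exp (- (C * (real r + real n / \<rho> (real r)))) \<le> inf_return n"
proof -
  let ?I = "\<lambda>r. integral {0..r} (\<lambda>s. s / \<rho> s)"
  obtain C r0 where C: "C \<ge> 1" and low: "\<And>r n. r \<ge> r0 \<Longrightarrow> C * (?I (real r) / (real r)\<^sup>2) \<le> 1 / 2 \<Longrightarrow>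
    exp (- (C * (real r + real n * (?I (real r) / (real r)\<^sup>2)))) \<le> inf_return n"
    using group.weak_return_inf_lower_bound[OF G S cont mono ge1 ret] by blast
  obtain D where D: "D > 0" "\<And>r. r \<ge> T \<Longrightarrow> ?I r / r\<^sup>2 \<le> D / \<rho> r"
    using ratio_average_Karamata[OF cont mono ge1 assms] by blast
  have "eventually (\<lambda>r. ?I r / r\<^sup>2 \<le> 1 / (2 * C)) at_top"
    using C by (intro ratio_average_small[OF cont mono ge1 top]) auto
  then obtain R where R: "\<And>r. r \<ge> R \<Longrightarrow> ?I r / r\<^sup>2 \<le> 1 / (2 * C)"
    by (auto simp: eventually_at_top_linorder)
  have C1: "1 \<le> C * max 1 D" using mult_mono[of 1 C 1 "max 1 D"] C by simp
  have "exp (- (C * max 1 D * (real r + real n / \<rho> (real r)))) \<le> inf_return n"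
    if r: "max T (max R (real r0)) \<le> real r" for r n
  proof -
    have \<rho>: "\<rho> (real r) > 0" using ge1[of "real r"] by simp
    have "?I (real r) / (real r)\<^sup>2 \<le> 1 / (2 * C)" using R r by simp
    then have J': "C * (?I (real r) / (real r)\<^sup>2) \<le> 1 / 2" using C by (simp add: field_simps)
    have "real n * (?I (real r) / (real r)\<^sup>2) \<le> real n * (D / \<rho> (real r))"
      using D(2)[of "real r"] r by (intro mult_left_mono) auto
    also have "\<dots> = D * (real n / \<rho> (real r))" by simp
    also have "\<dots> \<le> max 1 D * (real n / \<rho> (real r))" using \<rho> by (intro mult_right_mono) auto
    finally have "real n * (?I (real r) / (real r)\<^sup>2) \<le> max 1 D * (real n / \<rho> (real r))" .
    moreover have "1 * real r \<le> max 1 D * real r" by (intro mult_right_mono) auto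
    ultimately have "C * (real r + real n * (?I (real r) / (real r)\<^sup>2))
      \<le> C * (max 1 D * real r + max 1 D * (real n / \<rho> (real r)))"
      using C by (intro mult_left_mono add_mono) auto
    then have "exp (- (C * max 1 D * (real r + real n / \<rho> (real r))))
      \<le> exp (- (C * (real r + real n * (?I (real r) / (real r)\<^sup>2))))"
      by (simp add: distrib_left mult.assoc)
    also have "\<dots> \<le> inf_return n" using low[OF _ J'] r by auto
    finally show ?thesis .
  qed
  moreover have "1 \<le> max T (max R (real r0))" using assms(3) by simp
  ultimately show ?thesis using C1 by blast
qed

text \<open>With \<open>r\<close> near \<open>t\<^sup>\<beta>\<close>, \<open>\<beta> = 1 / (1 + \<alpha>)\<close>, the two terms \<open>r\<close> and \<open>t / \<rho> r\<close> of the exponent are both of order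
  \<open>t\<^sup>\<beta>\<close>.\<close>

lemma lower_bound_power_moment:
  assumes \<alpha>: "0 < \<alpha>" "\<alpha> < 2" and \<rho>: "\<And>s. s \<ge> 0 \<Longrightarrow> \<rho> s = (1 + s) powr \<alpha>"
  shows "real_ext inf_return \<greatersim>\<^sub>d (\<lambda>t. exp (- (t powr (1 / (1 + \<alpha>)))))"
proof -
  define \<beta> where "\<beta> = 1 / (1 + \<alpha>)"
  have \<beta>: "\<beta> > 0" "1 - \<beta> * \<alpha> = \<beta>" using \<alpha> by (auto simp: \<beta>_def field_simps)
  have growth: "\<rho> r \<le> 1 * (r / s) powr \<alpha> * \<rho> s" if "1 \<le> s" "s \<le> r" for s r
  proof -
    have "1 + r \<le> r / s * (1 + s)" using that by (simp add: field_simps)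
    then have "(1 + r) powr \<alpha> \<le> (r / s * (1 + s)) powr \<alpha>" using that \<alpha> by (intro powr_mono2) auto
    also have "\<dots> = (r / s) powr \<alpha> * (1 + s) powr \<alpha>" by (rule powr_mult)
    finally show ?thesis using \<rho>[of r] \<rho>[of s] that by simp
  qed
  obtain C R where C: "C \<ge> 1" and low: "\<And>r n. R \<le> real r \<Longrightarrow> exp (- (C * (real r + real n / \<rho> (real r)))) \<le> inf_return n"
    using lower_bound_subquadratic[of \<alpha> 1 1, OF _ _ _ _ growth] \<alpha> by auto
  define c where "c = (3 * C) powr (1 / \<beta>)"
  have c: "c > 0" using C by (simp add: c_def)
  have main: "real_ext inf_return t \<ge> 1 * exp (- ((c * t) powr \<beta>))" if t: "t \<ge> 1" "t powr \<beta> \<ge> R" for t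
  proof -
    define x where "x = t powr \<beta>"
    define r where "r = nat \<lceil>x\<rceil>"
    define n where "n = nat \<lfloor>t\<rfloor>"
    have x1: "x \<ge> 1" using t \<beta> by (simp add: x_def ge_one_powr_ge_zero)
    have r: "x \<le> real r" "real r \<le> 2 * x" "real r \<ge> R"
      using x1 t ceiling_le_double[OF x1] unfolding r_def x_def[symmetric] by linarith+
    have n: "real n \<le> t" using t unfolding n_def by linarith
    have "x powr \<alpha> \<le> \<rho> (real r)" using r x1 \<alpha> \<rho>[of "real r"] by (auto intro!: powr_mono2)
    then have "real n / \<rho> (real r) \<le> t / x powr \<alpha>" using n x1 t by (intro frac_le) auto
    also have "\<dots> = t powr (1 - \<beta> * \<alpha>)" using t by (simp add: x_def powr_powr powr_diff)
    also have "\<dots> = x" by (simp add: \<beta> x_def)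
    finally have "C * (real r + real n / \<rho> (real r)) \<le> C * (2 * x + x)"
      using C r by (intro mult_left_mono add_mono) auto
    also have "\<dots> = (c * t) powr \<beta>" using C t \<beta> by (simp add: c_def x_def powr_mult powr_powr)
    finally have "exp (- ((c * t) powr \<beta>)) \<le> exp (- (C * (real r + real n / \<rho> (real r))))" by simp
    also have "\<dots> \<le> inf_return n" by (rule low[OF r(3)])
    finally show ?thesis by (simp add: real_ext_def n_def)
  qed
  have "eventually (\<lambda>t::real. t powr \<beta> \<ge> R) at_top" using \<beta>(1) by real_asymp
  then have "eventually (\<lambda>t. real_ext inf_return t \<ge> 1 * exp (- ((c * t) powr \<beta>))) at_top"
    using eventually_ge_at_top[of 1] by eventually_elim (rule main)
  then show ?thesis
    unfolding dil_ge_def \<beta>_def using c by (intro exI[of _ 1] exI[of _ c] conjI) auto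
qed

text \<open>With \<open>r\<close> near \<open>t^(1/2)\<close> the hypothesis makes \<open>\<rho> r\<close> at least a multiple of \<open>\<rho> t\<close>, while \<open>r\<close> itself is
  at most a multiple of \<open>t / \<rho> t\<close> because \<open>\<rho> t\<close> is at most a multiple of \<open>t^(1/2)\<close>.\<close>

lemma lower_bound_slow_moment:
  assumes slow: "slowly_varying \<rho>" and half: "(\<lambda>s. \<rho> (s powr (1 / 2))) \<greatersim>\<^sub>d \<rho>"
  shows "real_ext inf_return \<greatersim>\<^sub>d (\<lambda>t. exp (- (t / \<rho> t)))"
proof -
  have ev_pos: "eventually (\<lambda>x. \<rho> x > 0) at_top"
    using eventually_ge_at_top[of 0] by eventually_elim (use ge1 in force)
  obtain T where T: "T \<ge> 1" and growth: "\<And>s r. T \<le> s \<Longrightarrow> s \<le> r \<Longrightarrow> \<rho> r \<le> sqrt 2 * (r / s) powr (1 / 2) * \<rho> s"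
    using slowly_varying_growth[OF cont mono ge1 slow] by blast
  obtain C R where C: "C \<ge> 1" and low: "\<And>r n. R \<le> real r \<Longrightarrow> exp (- (C * (real r + real n / \<rho> (real r)))) \<le> inf_return n"
    using lower_bound_subquadratic[OF _ _ T _ growth] by auto
  obtain k1 k2 where k: "k1 > 0" "k2 > 0"
    and ev1: "eventually (\<lambda>t. \<rho> (t powr (1 / 2)) \<ge> k1 * \<rho> (k2 * t)) at_top"
    using half unfolding dil_ge_def by auto
  have ev2: "eventually (\<lambda>t. \<rho> (k2 * t) \<ge> 1 / 2 * \<rho> t) at_top"
    using k by (intro eventually_dilate_ge slow ev_pos) auto
  define B where "B = sqrt 2 * \<rho> T"
  have B: "B > 0" using ge1[of T] T by (simp add: B_def)
  define D where "D = C * (2 * B + 2 / k1)"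
  have D: "D > 0" using C B k by (auto simp: D_def intro!: mult_pos_pos add_pos_pos)
  have ev3: "eventually (\<lambda>t. \<rho> (2 * D * t) \<le> 2 * \<rho> t) at_top"
    using D by (intro eventually_dilate_le slow ev_pos) auto
  have ev4: "eventually (\<lambda>t::real. t powr (1 / 2) \<ge> R) at_top" by real_asymp
  have "eventually (\<lambda>t. real_ext inf_return t \<ge> 1 * exp (- (2 * D * t / \<rho> (2 * D * t)))) at_top"
    using ev1 ev2 ev3 ev4 eventually_ge_at_top[of T]
  proof eventually_elim
    case (elim t)
    define x where "x = t powr (1 / 2)"
    define r where "r = nat \<lceil>x\<rceil>"
    define n where "n = nat \<lfloor>t\<rfloor>"
    have t: "t \<ge> 1" using T elim by simp
    have x1: "x \<ge> 1" using t by (simp add: x_def ge_one_powr_ge_zero)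
    have xx: "x * x = t" using t by (simp add: x_def powr_add[symmetric])
    have r: "x \<le> real r" "real r \<le> 2 * x" "real r \<ge> R"
      using x1 elim ceiling_le_double[OF x1] unfolding r_def x_def[symmetric] by linarith+
    have n: "real n \<le> t" using t unfolding n_def by linarith
    have \<rho>t: "\<rho> t > 0" using ge1[of t] t by simp
    have "k1 * (1 / 2 * \<rho> t) \<le> k1 * \<rho> (k2 * t)" using elim k by (intro mult_left_mono) auto
    also have "\<dots> \<le> \<rho> x" using elim by (simp add: x_def)
    also have "\<dots> \<le> \<rho> (real r)" using r x1 by (intro mono_onD[OF mono]) auto
    finally have "real n / \<rho> (real r) \<le> t / (k1 * (1 / 2 * \<rho> t))"
      using n t k \<rho>t by (intro frac_le) auto
    also have "\<dots> = 2 / k1 * (t / \<rho> t)" using k \<rho>t by (simp add: field_simps)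
    finally have 1: "real n / \<rho> (real r) \<le> 2 / k1 * (t / \<rho> t)" .
    have "\<rho> t \<le> sqrt 2 * (t / T) powr (1 / 2) * \<rho> T" using growth elim by simp
    also have "\<dots> \<le> sqrt 2 * x * \<rho> T"
    proof (intro mult_right_mono mult_left_mono)
      have "t / T \<le> t / 1" using T t by (intro divide_left_mono) auto
      then show "(t / T) powr (1 / 2) \<le> x" unfolding x_def using T t by (intro powr_mono2) auto
    qed (use ge1[of T] T in auto)
    finally have "x * \<rho> t \<le> x * (B * x)" using x1 by (intro mult_left_mono) (auto simp: B_def mult_ac)
    then have "x * \<rho> t \<le> B * t" using xx by (simp add: mult_ac)
    then have "x \<le> B * (t / \<rho> t)" using \<rho>t by (simp add: field_simps)
    then have "real r \<le> 2 * B * (t / \<rho> t)" using r by simp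
    with 1 have "C * (real r + real n / \<rho> (real r)) \<le> C * (2 * B * (t / \<rho> t) + 2 / k1 * (t / \<rho> t))"
      using C by (intro mult_left_mono add_mono) auto
    also have "\<dots> = D * (t / \<rho> t)" by (simp add: D_def algebra_simps)
    also have "\<dots> = 2 * D * t / (2 * \<rho> t)" by simp
    also have "\<dots> \<le> 2 * D * t / \<rho> (2 * D * t)"
      using elim D t ge1[of "2 * D * t"] by (intro divide_left_mono) (auto intro!: mult_pos_pos)
    finally have "exp (- (2 * D * t / \<rho> (2 * D * t))) \<le> exp (- (C * (real r + real n / \<rho> (real r))))" by simp
    also have "\<dots> \<le> inf_return n" by (rule low[OF r(3)])
    finally show ?case by (simp add: real_ext_def n_def)
  qed
  then show ?thesis
    unfolding dil_ge_def using D by (intro exI[of _ 1] exI[of _ "2 * D"] conjI) (auto simp: mult.assoc)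
qed

end

context
  assumes growth: "exponential_growth G S"
begin

lemma inf_return_upper_bound:
  "\<exists>c>0. \<forall>n r. inf_return n \<le> exp (- (2 * real n / \<rho> (real r))) + exp (- (c * real r))"
proof -
  obtain c where c: "c > 0" "\<And>n. exp (c * real n) \<le> real (volume G S n)"
    using growth unfolding exponential_growth_def by auto
  have "inf_return n \<le> exp (- (2 * real n / \<rho> (real r))) + exp (- (c * real r))" for n r
  proof -
    have "2 * real n * 1 / \<rho> (real r) \<le> 2 * real n * \<rho> 0 / \<rho> (real r)"
      using ge1[of 0] ge1[of "real r"] by (intro divide_right_mono mult_left_mono) auto
    then have "exp (- (2 * real n * \<rho> 0 / \<rho> (real r))) \<le> exp (- (2 * real n / \<rho> (real r)))" by simp
    then show ?thesis
      using group.weak_return_inf_upper_bound[OF G S cont mono ge1 c, of n r] by linarith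
  qed
  then show ?thesis using c(1) by blast
qed

text \<open>The same radius as for the lower bound, scaled by \<open>A\<close> so that the volume of the ball is at least
  \<open>exp (t\<^sup>\<beta>)\<close>.\<close>

lemma upper_bound_power_moment:
  assumes \<alpha>: "0 < \<alpha>" and \<rho>: "\<And>s. s \<ge> 0 \<Longrightarrow> \<rho> s = (1 + s) powr \<alpha>"
  shows "(\<lambda>t. exp (- (t powr (1 / (1 + \<alpha>))))) \<greatersim>\<^sub>d real_ext inf_return"
proof -
  define \<beta> where "\<beta> = 1 / (1 + \<alpha>)"
  have \<beta>: "\<beta> > 0" "1 - \<beta> * \<alpha> = \<beta>" using \<alpha> by (auto simp: \<beta>_def field_simps)
  obtain c where c: "c > 0" and up: "\<And>n r. inf_return n \<le> exp (- (2 * real n / \<rho> (real r))) + exp (- (c * real r))"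
    using inf_return_upper_bound by blast
  define A where "A = max 1 (1 / c)"
  have A: "A \<ge> 1" "c * A \<ge> 1" using c by (auto simp: A_def max_def field_simps)
  define c2 where "c2 = (3 * A) powr \<alpha>"
  have c2: "c2 \<ge> 1" unfolding c2_def using A \<alpha> by (intro ge_one_powr_ge_zero) auto
  have main: "exp (- (t powr \<beta>)) \<ge> 1 / 2 * real_ext inf_return (c2 * t)" if t: "t \<ge> 2" for t
  proof -
    define x where "x = t powr \<beta>"
    define r where "r = nat \<lceil>A * x\<rceil>"
    define n where "n = nat \<lfloor>c2 * t\<rfloor>"
    have x1: "x \<ge> 1" using t \<beta> by (simp add: x_def ge_one_powr_ge_zero)
    have Ax: "A * x \<ge> 1" using mult_mono[of 1 A 1 x] A x1 by simp
    have r: "A * x \<le> real r" "1 + real r \<le> 3 * A * x"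
      using Ax unfolding r_def by linarith+
    have "c2 * t \<ge> 2" using mult_mono[of 1 c2 2 t] c2 t by simp
    then have n: "c2 * t \<le> 2 * real n" using half_le_floor[of "c2 * t"] by (simp add: n_def)
    have "\<rho> (real r) \<le> (3 * A * x) powr \<alpha>" using r \<rho>[of "real r"] \<alpha> by (auto intro!: powr_mono2)
    also have "\<dots> = c2 * t powr (\<beta> * \<alpha>)" using A x1 by (simp add: c2_def powr_mult x_def powr_powr)
    finally have "c2 * t / (c2 * t powr (\<beta> * \<alpha>)) \<le> 2 * real n / \<rho> (real r)"
      using n ge1[of "real r"] by (intro frac_le) auto
    moreover have "c2 * t / (c2 * t powr (\<beta> * \<alpha>)) = t powr (1 - \<beta> * \<alpha>)"
      using c2 t by (simp add: powr_diff)
    ultimately have "x \<le> 2 * real n / \<rho> (real r)" by (simp add: \<beta> x_def)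
    moreover have "x \<le> c * real r"
    proof -
      have "1 * x \<le> (c * A) * x" using A x1 by (intro mult_right_mono) auto
      also have "\<dots> \<le> c * real r" using r c by (simp add: mult.assoc)
      finally show ?thesis by simp
    qed
    ultimately have "exp (- (2 * real n / \<rho> (real r))) + exp (- (c * real r)) \<le> exp (- x) + exp (- x)"
      by (intro add_mono) auto
    then have "inf_return n \<le> 2 * exp (- x)" using up[of n r] by linarith
    then show ?thesis by (simp add: real_ext_def n_def x_def)
  qed
  have "eventually (\<lambda>t. exp (- (t powr \<beta>)) \<ge> 1 / 2 * real_ext inf_return (c2 * t)) at_top"
    using eventually_ge_at_top[of 2] by eventually_elim (rule main)
  then show ?thesis
    unfolding dil_ge_def \<beta>_def using c2 by (intro exI[of _ "1 / 2"] exI[of _ c2] conjI) auto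
qed

text \<open>A radius proportional to \<open>t\<close> suffices: slow variation keeps \<open>\<rho> r\<close> comparable with \<open>\<rho> t\<close>, and the volume
  of the ball is at least \<open>exp t\<close>.\<close>

lemma upper_bound_slow_moment:
  assumes slow: "slowly_varying \<rho>"
  shows "(\<lambda>t. exp (- (t / \<rho> t))) \<greatersim>\<^sub>d real_ext inf_return"
proof -
  have ev_pos: "eventually (\<lambda>x. \<rho> x > 0) at_top"
    using eventually_ge_at_top[of 0] by eventually_elim (use ge1 in force)
  obtain c where c: "c > 0" and up: "\<And>n r. inf_return n \<le> exp (- (2 * real n / \<rho> (real r))) + exp (- (c * real r))"
    using inf_return_upper_bound by blast
  define A where "A = max 1 (1 / c)"
  have A: "A \<ge> 1" "c * A \<ge> 1" using c by (auto simp: A_def max_def field_simps)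
  have "eventually (\<lambda>t. \<rho> (2 * A * t) \<le> 2 * \<rho> t) at_top"
    using A by (intro eventually_dilate_le slow ev_pos) auto
  then have "eventually (\<lambda>t. exp (- (t / \<rho> t)) \<ge> 1 / 2 * real_ext inf_return (2 * t)) at_top"
    using eventually_ge_at_top[of 1]
  proof eventually_elim
    case (elim t)
    define r where "r = nat \<lceil>A * t\<rceil>"
    define n where "n = nat \<lfloor>2 * t\<rfloor>"
    have At: "A * t \<ge> 1" using mult_mono[of 1 A 1 t] A elim by simp
    have r: "A * t \<le> real r" "real r \<le> 2 * A * t"
      using At unfolding r_def by linarith+
    have n: "t \<le> real n" using half_le_floor[of "2 * t"] elim by (simp add: n_def)
    have \<rho>t: "\<rho> t \<ge> 1" using ge1[of t] elim by simp
    have "\<rho> (real r) \<le> \<rho> (2 * A * t)" using r At by (intro mono_onD[OF mono]) auto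
    then have "\<rho> (real r) \<le> 2 * \<rho> t" using elim by linarith
    then have "2 * t / (2 * \<rho> t) \<le> 2 * real n / \<rho> (real r)"
      using n ge1[of "real r"] by (intro frac_le) auto
    then have "t / \<rho> t \<le> 2 * real n / \<rho> (real r)" by simp
    moreover have "t / \<rho> t \<le> c * real r"
    proof -
      have "t / \<rho> t \<le> 1 * t" using \<rho>t elim by (simp add: divide_le_eq mult_le_cancel_left1)
      also have "\<dots> \<le> (c * A) * t" using A elim by (intro mult_right_mono) auto
      also have "\<dots> \<le> c * real r" using r c by (simp add: mult.assoc)
      finally show ?thesis .
    qed
    ultimately have "exp (- (2 * real n / \<rho> (real r))) + exp (- (c * real r))
        \<le> exp (- (t / \<rho> t)) + exp (- (t / \<rho> t))"
      by (intro add_mono) auto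
    then have "inf_return n \<le> 2 * exp (- (t / \<rho> t))" using up[of n r] by linarith
    then show ?case by (simp add: real_ext_def n_def)
  qed
  then show ?thesis
    unfolding dil_ge_def by (intro exI[of _ "1 / 2"] exI[of _ 2] conjI) auto
qed

end
end

theorem corollary3p4:
  fixes G :: "('a, 'b) monoid_scheme" and S :: "'a set" and \<rho> l :: "real \<Rightarrow> real"
  assumes "group G"
    and "symmetric_generating_set G S"
    and "exponential_growth G S"
    and "real_ext (return_prob G S) \<simeq>\<^sub>d (\<lambda>t. exp (- (t powr (1/3))))"
    and "continuous_on {0..} \<rho>" and "mono_on {0..} \<rho>" and "\<And>t. t \<ge> 0 \<Longrightarrow> \<rho> t \<ge> 1"
    and "continuous_on {0..} l" and "mono_on {0..} l" and "\<And>t. t \<ge> 0 \<Longrightarrow> l t \<ge> 1"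
    and "\<exists>\<beta>\<ge>0. regularly_varying \<beta> l"
    and "(\<lambda>s. 1 / ((1 + s) * l s)) integrable_on {0..}"
    and "\<rho> \<simeq>\<^sub>d (\<lambda>t. inverse (integral {t..} (\<lambda>s. 1 / ((1 + s) * l s))))"
  shows "(regularly_varying 2 \<rho> \<longrightarrow>
            real_ext (weak_return_inf G S \<rho>) \<greatersim>\<^sub>d
              (\<lambda>t. exp (- (t powr (1/3) * integral {0..t powr (1/3)} (\<lambda>s. s / \<rho> s)))))
       \<and> (\<forall>\<alpha>. 0 < \<alpha> \<and> \<alpha> < 2 \<and> (\<forall>s\<ge>0. \<rho> s = (1 + s) powr \<alpha>) \<longrightarrow>
            real_ext (weak_return_inf G S \<rho>) \<simeq>\<^sub>d (\<lambda>t. exp (- (t powr (1 / (1 + \<alpha>))))))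
       \<and> (slowly_varying \<rho> \<and> (\<forall>a>0. (\<lambda>s. \<rho> (s powr a)) \<simeq>\<^sub>d \<rho>) \<longrightarrow>
            real_ext (weak_return_inf G S \<rho>) \<simeq>\<^sub>d (\<lambda>t. exp (- (t / \<rho> t))))"
proof -
  have top: "filterlim \<rho> at_top at_top"
    using assms(9,10,12,13) by (intro inverse_tail_at_top[of l]) (auto simp: dil_equiv_def)
  have ret: "real_ext (return_prob G S) \<greatersim>\<^sub>d (\<lambda>t. exp (- (t powr (1/3))))"
    using assms(4) by (simp add: dil_equiv_def)
  note setting = assms(1,2,5,6,7) top
  show ?thesis
  proof (intro conjI impI allI)
    show "real_ext (weak_return_inf G S \<rho>) \<greatersim>\<^sub>d
              (\<lambda>t. exp (- (t powr (1/3) * integral {0..t powr (1/3)} (\<lambda>s. s / \<rho> s))))"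
      by (rule lower_bound_ratio_integral[OF setting ret])
  next
    fix \<alpha> assume \<alpha>: "0 < \<alpha> \<and> \<alpha> < 2 \<and> (\<forall>s\<ge>0. \<rho> s = (1 + s) powr \<alpha>)"
    then show "real_ext (weak_return_inf G S \<rho>) \<simeq>\<^sub>d (\<lambda>t. exp (- (t powr (1 / (1 + \<alpha>)))))"
      unfolding dil_equiv_def
      using lower_bound_power_moment[OF setting ret, of \<alpha>] upper_bound_power_moment[OF setting assms(3), of \<alpha>] by blast
  next
    assume *: "slowly_varying \<rho> \<and> (\<forall>a>0. (\<lambda>s. \<rho> (s powr a)) \<simeq>\<^sub>d \<rho>)"
    then have "(\<lambda>s. \<rho> (s powr (1 / 2))) \<greatersim>\<^sub>d \<rho>"
      unfolding dil_equiv_def by (meson half_gt_zero zero_less_one)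
    then show "real_ext (weak_return_inf G S \<rho>) \<simeq>\<^sub>d (\<lambda>t. exp (- (t / \<rho> t)))"
      unfolding dil_equiv_def
      using * lower_bound_slow_moment[OF setting ret] upper_bound_slow_moment[OF setting assms(3)] by blast
  qed
qed

end
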